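(* Consider the continuous-time algorithm $$\dot q(t)=p(t),\qquad \dot p(t)=-2d\,p(t)-\nabla f\big(q(t)+\beta p(t)\big),\qquad t\ge 0,$$ where the parameters $d=d(\kappa)$ and $\beta=\beta(\kappa)$ may depend on $\kappa$. Let $A\subset\mathbb{R}^{2n}$ be a fixed compact set containing the origin. (i) Nonconvex case ($C_{\mathrm f}>0$): the algorithm is accelerated for the set of parameters satisfying $d\sim 1/\sqrt{\kappa}$, $0<d$, and $0\le\beta<2d/C_{\mathrm f}$. (ii) Convex case ($C_{\mathrm f}=0$): the algorithm is accelerated for the set of parameters satisfying $d+\beta/(2\kappa)\sim 1/\sqrt{\kappa}$, $0<d$, and $0\le\beta$.
   Context: Here $|\cdot|$ is the Euclidean norm, and $\varphi_t$ denotes the flow $(q(0),p(0))\mapsto(q(t),p(t))$, $t\in I=\mathbb{R}_{\ge0}$. Asymptotic notation: for real-valued functions $u_1,u_2$ of $\kappa$ that are positive for large arguments, $u_1\sim u_2$ means $\lim_{\kappa\to\infty}u_1(\kappa)/u_2(\kappa)<\infty$ and $\lim_{\kappa\to\infty}u_2(\kappa)/u_1(\kappa)<\infty$. Local curvature: for $f:\mathbb{R}^n\to\mathbb{R}$ with an isolated non-degenerate local minimum at $0$, $\mu$ and $L$ denote the smallest and largest eigenvalue of the Hessian of $f$ at $0$, and the condition number is $L/\mu$. Functions are normalized so that $L=1$; hence if the condition number is at most $\kappa$, every eigenvalue $h$ of the Hessian at $0$ satisfies $1/\kappa\le h\le1$. The set $\mathcal{A}_f$: let $H(q,p)=\frac12|p|^2+f(q)$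 and let $\hat f$ be the smallest value of $f$ at critical points of $f$ other than the origin ($\hat f=+\infty$ if there are none). $\mathcal{A}_f$ is the connected component of $H^{-1}([0,\hat f))$ that contains the origin. It is a standing property that for every $0<c<\hat f$ the connected component of $H^{-1}([0,c])$ containing the origin is compact and contains no other critical point. Function class: for $\bar\kappa\ge1$, $C_{\mathrm f}\ge0$, $\bar C_{\mathrm f}>0$, let $\mathcal{F}_{\bar\kappa,C_{\mathrm f},\bar C_{\mathrm f}}$ be the set of all $f:\mathbb{R}^n\to\mathbb{R}$ such that (1) $f$ has an isolated local minimum at the origin with $f(0)=0$ and with condition number at most $\bar\kappa$; (2) $f$ has Lipschitz-continuous gradient, its critical points are isolated and non-degenerate, its second derivative is Lipschitz continuous, and $-C_{\mathrm f}|u|^2\le u^{\top}\frac{\partial^2 f}{\partial x^2}(x)\,u\le\bar C_{\mathrm f}|u|^2$ for all $u,x\in\mathbb{R}^n$; (3) $\mathcal{A}_f\supset A$. Acceleration: the algorithm is called accelerated if there exist constants $\kappa_0\ge1$ and $c_{\mathrm a}>0$ such that for any $\kappa\ge\kappa_0$ and any $f\in\mathcal{F}_{\kappa,C_{\mathrm f},\bar C_{\mathrm f}}$ (the algorithm being run with $d(\kappa),\beta(\kappa)$) there is a constant $C_{\mathrm a}>0$, which may depend on $f$, with $|\varphi_t(z_0)|\le C_{\mathrm a}|z_0|\exp(-c_{\mathrm a}t/\sqrt{\kappa})$ for all $t\in I$ and all $z_0\in A$. *)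

theory Defs
  imports "HOL-Analysis.Analysis"
begin

definition same_order :: "(real \<Rightarrow> real) \<Rightarrow> (real \<Rightarrow> real) \<Rightarrow> bool"  (infix \<open>\<asymp>\<close> 50) where
  "u1 \<asymp> u2 \<longleftrightarrow>
     (\<forall>\<^sub>F \<kappa> in at_top. u1 \<kappa> > 0) \<and> (\<forall>\<^sub>F \<kappa> in at_top. u2 \<kappa> > 0) \<and>
     (\<exists>l::real. ((\<lambda>\<kappa>. u1 \<kappa> / u2 \<kappa>) \<longlongrightarrow> l) at_top) \<and>
     (\<exists>l::real. ((\<lambda>\<kappa>. u2 \<kappa> / u1 \<kappa>) \<longlongrightarrow> l) at_top)"

definition grad :: "('a::real_inner \<Rightarrow> real) \<Rightarrow> 'a \<Rightarrow> 'a" where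
  "grad f x = (THE D. GDERIV f x :> D)"

definition hessian :: "(real^'n \<Rightarrow> real) \<Rightarrow> real^'n \<Rightarrow> real^'n^'n" where
  "hessian f x = jacobian (grad f) (at x)"

definition critical_points :: "('a::real_inner \<Rightarrow> real) \<Rightarrow> 'a set" where
  "critical_points f = {x. grad f x = 0}"

definition isolated_local_min :: "('a::topological_space \<Rightarrow> real) \<Rightarrow> 'a \<Rightarrow> bool" where
  "isolated_local_min f x \<longleftrightarrow> x isolated_in {y. \<forall>\<^sub>F z in nhds y. f y \<le> f z}"

definition eigenvalues :: "real^'n^'n \<Rightarrow> real set" where
  "eigenvalues M = {h. \<exists>v. v \<noteq> 0 \<and> M *v v = h *\<^sub>R v}"

definition min_curvature :: "(real^'n \<Rightarrow> real) \<Rightarrow> real" where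
  "min_curvature f = Min (eigenvalues (hessian f 0))"

definition max_curvature :: "(real^'n \<Rightarrow> real) \<Rightarrow> real" where
  "max_curvature f = Max (eigenvalues (hessian f 0))"

definition condition_number :: "(real^'n \<Rightarrow> real) \<Rightarrow> real" where
  "condition_number f = max_curvature f / min_curvature f"

text \<open>The phase space is the product type, whose norm is the Euclidean norm of the pair.\<close>

definition hamiltonian :: "(real^'n \<Rightarrow> real) \<Rightarrow> (real^'n) \<times> (real^'n) \<Rightarrow> real" where
  "hamiltonian f = (\<lambda>(q, p). (norm p)\<^sup>2 / 2 + f q)"

text \<open>The infimum is taken in the extended reals, so it is \<open>\<infinity>\<close> when the
  origin is the only critical point.\<close>

definition f_hat :: "(real^'n \<Rightarrow> real) \<Rightarrow> ereal" where
  "f_hat f = (INF x \<in> critical_points f - {0}. ereal (f x))"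

definition A_set :: "(real^'n \<Rightarrow> real) \<Rightarrow> ((real^'n) \<times> (real^'n)) set" where
  "A_set f =
     connected_component_set {z. 0 \<le> hamiltonian f z \<and> ereal (hamiltonian f z) < f_hat f} 0"

text \<open>Compactness of the sublevel components does not follow from the other requirements on
  \<open>f\<close>: take \<open>f x = x\<^sup>2 / (2 * (1 + x\<^sup>2))\<close> on the line, where \<open>f_hat f = \<infinity>\<close>.\<close>

definition compact_level_components :: "(real^'n \<Rightarrow> real) \<Rightarrow> bool" where
  "compact_level_components f \<longleftrightarrow>
     (\<forall>c. 0 < c \<and> ereal c < f_hat f \<longrightarrow>
        (let K = connected_component_set {z. hamiltonian f z \<in> {0..c}} 0
         in compact K \<and> K \<inter> critical_points (hamiltonian f) \<subseteq> {0}))"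

text \<open>The conjunct \<open>max_curvature f = 1\<close> is the normalization of the functions.\<close>

definition function_class ::
  "((real^'n) \<times> (real^'n)) set \<Rightarrow> real \<Rightarrow> real \<Rightarrow> real \<Rightarrow> (real^'n \<Rightarrow> real) set" where
  "function_class A \<kappa> Cf Cf' = {f.
     isolated_local_min f 0 \<and> f 0 = 0 \<and> max_curvature f = 1 \<and> condition_number f \<le> \<kappa> \<and>
     (\<forall>x. f differentiable (at x)) \<and>
     (\<exists>l. l-lipschitz_on UNIV (grad f)) \<and>
     (\<forall>x. grad f differentiable (at x)) \<and>
     discrete (critical_points f) \<and>
     (\<forall>x\<in>critical_points f. invertible (hessian f x)) \<and>
     (\<exists>l. l-lipschitz_on UNIV (hessian f)) \<and>
     (\<forall>u x. - Cf * (norm u)\<^sup>2 \<le> u \<bullet> (hessian f x *v u) \<and>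
            u \<bullet> (hessian f x *v u) \<le> Cf' * (norm u)\<^sup>2) \<and>
     compact_level_components f \<and>
     A \<subseteq> A_set f}"

definition vector_field ::
  "real \<Rightarrow> real \<Rightarrow> (real^'n \<Rightarrow> real) \<Rightarrow> (real^'n) \<times> (real^'n) \<Rightarrow> (real^'n) \<times> (real^'n)" where
  "vector_field d \<beta> f = (\<lambda>(q, p). (p, - (2 * d) *\<^sub>R p - grad f (q + \<beta> *\<^sub>R p)))"

definition trajectory ::
  "real \<Rightarrow> real \<Rightarrow> (real^'n \<Rightarrow> real) \<Rightarrow> (real \<Rightarrow> (real^'n) \<times> (real^'n)) \<Rightarrow> bool" where
  "trajectory d \<beta> f z \<longleftrightarrow>
     (\<forall>t\<ge>0. (z has_vector_derivative vector_field d \<beta> f (z t)) (at t within {0..}))"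

definition flow ::
  "real \<Rightarrow> real \<Rightarrow> (real^'n \<Rightarrow> real) \<Rightarrow> real \<Rightarrow> (real^'n) \<times> (real^'n) \<Rightarrow> (real^'n) \<times> (real^'n)" where
  "flow d \<beta> f t z0 = (THE w. \<exists>z. trajectory d \<beta> f z \<and> z 0 = z0 \<and> z t = w)"

definition accelerated ::
  "((real^'n) \<times> (real^'n)) set \<Rightarrow> real \<Rightarrow> real \<Rightarrow> (real \<Rightarrow> real) \<Rightarrow> (real \<Rightarrow> real) \<Rightarrow> bool" where
  "accelerated A Cf Cf' d \<beta> \<longleftrightarrow>
     (\<exists>\<kappa>0\<ge>1. \<exists>ca>0. \<forall>\<kappa>\<ge>\<kappa>0. \<forall>f\<in>function_class A \<kappa> Cf Cf'. \<exists>Ca>0. \<forall>t\<ge>0. \<forall>z0\<in>A.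
        norm (flow (d \<kappa>) (\<beta> \<kappa>) f t z0) \<le> Ca * norm z0 * exp (- ca * t / sqrt \<kappa>))"

end

theory Submission
  imports Defs
begin

text \<open>
  Write \<open>g\<close> for the gradient, \<open>Q\<close> for the Hessian of \<open>f\<close> at the origin and \<open>D = d + \<beta> / (2 \<kappa>)\<close>; in both
  cases \<open>D\<close> is of order \<open>1 / sqrt \<kappa>\<close> and \<open>C\<^sub>f \<beta> < 2 d\<close>.

  Rate near the origin. With \<open>\<gamma>\<close> a small multiple of \<open>1 / sqrt \<kappa>\<close>, the quadratic form
  \<open>W = |p|\<^sup>2 / 2 + q \<bullet> Q q / 2 + \<gamma> (q \<bullet> p + d |q|\<^sup>2 + \<beta> / 2 (q \<bullet> Q q))\<close> satisfies
  \<open>W' \<le> - \<gamma> (|p|\<^sup>2 + q \<bullet> Q q)\<close> along the linearized flow, because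
  \<open>2 d |p|\<^sup>2 + \<beta> (p \<bullet> Q p) \<ge> 2 D |p|\<^sup>2\<close>, while
  \<open>W \<le> M (|p|\<^sup>2 + q \<bullet> Q q)\<close> with \<open>M\<close> independent of \<open>f\<close> and \<open>\<kappa>\<close>. The nonlinear remainder costs half of the rate
  in a small ball.

  Reaching that ball. Along the flow \<open>H' \<le> - (2 d - C\<^sub>f \<beta>) |p|\<^sup>2\<close>, and \<open>H + \<epsilon> (p \<bullet> g(q))\<close> is a strict Lyapunov function,
  so every trajectory that stays in a compact set without critical points other than the origin enters the ball.
  The points whose trajectory enters the ball form an open set \<open>G\<close>, and \<open>G\<close> is relatively closed in the connected set
  \<open>A_set f\<close>: trajectories from \<open>G\<close> keep \<open>H \<ge> 0\<close> and connect their starting point to the origin, so a limit of points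
  of \<open>G\<close> lies, with its whole trajectory, in one of the compact level components. Hence \<open>A_set f\<close> is contained
  in \<open>G\<close>; the entry time is bounded on the compact set \<open>A\<close>, and Gronwall's inequality covers the time before it.
\<close>

section \<open>Differential equations with a Lipschitz right-hand side\<close>

lemma has_integral_exp_mult:
  fixes a t :: real
  assumes "a > 0" "0 \<le> t"
  shows "((\<lambda>s. exp (a * s)) has_integral (exp (a * t) - 1) / a) {0..t}"
proof -
  have "((\<lambda>s. exp (a * s)) has_integral (exp (a * t) / a - exp (a * 0) / a)) {0..t}"
    using assms
    by (intro fundamental_theorem_of_calculus)
      (auto intro!: derivative_eq_intros simp: has_real_derivative_iff_has_vector_derivative[symmetric])
  then show ?thesis by (simp add: diff_divide_distrib)
qed

text \<open>Picard's operator is a contraction on all of \<open>{0..}\<close> at once for the norm weighted by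
  \<open>exp (- a * t)\<close> with \<open>a > L\<close>, so no continuation argument is needed.\<close>

lemma lipschitz_ode_solution_exists:
  fixes F :: "'a::banach \<Rightarrow> 'a"
  assumes F: "L-lipschitz_on UNIV F"
  obtains z where "z 0 = z0"
    and "\<And>t. 0 \<le> t \<Longrightarrow> (z has_vector_derivative F (z t)) (at t within {0..})"
proof -
  have L: "0 \<le> L" using F by (rule lipschitz_on_nonneg)
  have contF: "continuous_on UNIV F" using F by (rule lipschitz_on_continuous_on)
  \<comment> \<open>The contraction factor will be \<open>L / a\<close>; doubling \<open>L\<close>
    brings it to at most 1/2, and the added 1 keeps \<open>a\<close> positive when
    \<open>L = 0\<close>.\<close>
  define a where "a = 2 * L + 1"
  have a: "a > 0" "L / a \<le> 1/2" using L by (auto simp: a_def field_simps)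
  \<comment> \<open>A candidate solution is represented by \<open>y\<close>, which is the candidate
    times \<open>exp (- a * s)\<close>. \<open>G\<close> is Picard's operator without the weight and
    \<open>P\<close> puts the weight back; \<open>max 0 t\<close> continues \<open>P y\<close> as a
    constant to negative times, because \<open>bcontfun\<close> lives on the whole line.\<close>
  define f where "f y s = F (exp (a * s) *\<^sub>R apply_bcontfun y s)" for y :: "real \<Rightarrow>\<^sub>C 'a" and s
  define G where "G y t = z0 + integral {0..t} (f y)" for y :: "real \<Rightarrow>\<^sub>C 'a" and t
  define P where "P y t = exp (- a * max 0 t) *\<^sub>R G y (max 0 t)" for y :: "real \<Rightarrow>\<^sub>C 'a" and t
  have contf: "continuous_on S (f y)" for S and y :: "real \<Rightarrow>\<^sub>C 'a"
    unfolding f_def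
    by (intro continuous_on_compose2[OF contF] continuous_intros) auto
  have intf: "f y integrable_on {0..t}" for y :: "real \<Rightarrow>\<^sub>C 'a" and t
    by (rule integrable_continuous_real[OF contf])
  have derG: "(G y has_vector_derivative f y t) (at t within {0..})" if "0 \<le> t" for y t
  proof -
    have "((\<lambda>u. integral {0..u} (f y)) has_vector_derivative f y t) (at t within {0..t + 1})"
      using that by (intro integral_has_vector_derivative contf) auto
    moreover have "at t within {0..t + 1} = at t within {0..}"
      by (rule at_within_nhd[where S = "{..<t + 1}"]) auto
    ultimately show ?thesis unfolding G_def
      by (auto intro!: derivative_eq_intros)
  qed
  have contG: "continuous_on {0..} (G y)" for y
    using derG by (auto simp: continuous_on_eq_continuous_within intro!: has_vector_derivative_continuous)
  have contP: "continuous_on UNIV (P y)" for y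
    unfolding P_def
    by (intro continuous_intros continuous_on_compose2[OF contG]) auto
  have exp_int: "(\<lambda>s. c * exp (a * s)) integrable_on {0..t}"
      "integral {0..t} (\<lambda>s. c * exp (a * s)) = c * ((exp (a * t) - 1) / a)" if "0 \<le> t" for c t
    using has_integral_mult_right[OF has_integral_exp_mult[OF a(1) that], of c]
    by (auto simp: has_integral_iff)
  \<comment> \<open>The weight turns an exponentially growing integral into a bound uniform in time;
    it serves both the boundedness of \<open>P y\<close> and the contraction estimate.\<close>
  have weight: "exp (- a * t) * (c * ((exp (a * t) - 1) / a)) \<le> c / a"
    if "0 \<le> t" "0 \<le> c" for c t
  proof -
    have "exp (- a * t) * (c * ((exp (a * t) - 1) / a)) = c / a * (1 - exp (- a * t))"
      using a by (simp add: exp_minus field_simps)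
    also have "\<dots> \<le> c / a * 1" using a that by (intro mult_left_mono) auto
    finally show ?thesis by simp
  qed
  have bddP: "norm (P y t) \<le> norm z0 + (norm (F 0) + L * norm y) / a" for y t
  proof -
    define s where "s = max 0 t"
    have s: "0 \<le> s" by (simp add: s_def)
    have fb: "norm (f y r) \<le> (norm (F 0) + L * norm y) * exp (a * r)" if "r \<in> {0..s}" for r
    proof -
      have "norm (f y r) \<le> norm (F 0) + norm (f y r - F 0)" by norm
      also have "norm (f y r - F 0) \<le> L * norm (exp (a * r) *\<^sub>R apply_bcontfun y r - 0)"
        unfolding f_def by (rule lipschitz_on_normD[OF F]) auto
      also have "\<dots> \<le> L * (exp (a * r) * norm y)"
        using L norm_bounded[of y r] by (auto intro!: mult_left_mono)
      also have "norm (F 0) \<le> norm (F 0) * exp (a * r)"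
        using that a by (simp add: mult_le_cancel_left1)
      finally show ?thesis by (simp add: algebra_simps)
    qed
    have "norm (integral {0..s} (f y)) \<le> (norm (F 0) + L * norm y) * ((exp (a * s) - 1) / a)"
      using integral_norm_bound_integral[OF intf exp_int(1)[OF s] fb] exp_int(2)[OF s] by simp
    then have "norm (P y t) \<le> exp (- a * s) * (norm z0 + (norm (F 0) + L * norm y) * ((exp (a * s) - 1) / a))"
      unfolding P_def G_def s_def[symmetric]
      by (auto intro!: mult_left_mono norm_triangle_le)
    also have "\<dots> = exp (- a * s) * norm z0
        + exp (- a * s) * ((norm (F 0) + L * norm y) * ((exp (a * s) - 1) / a))"
      by (simp add: distrib_left)
    also have "exp (- a * s) * norm z0 \<le> 1 * norm z0"
      using a s by (intro mult_right_mono) auto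
    also have "exp (- a * s) * ((norm (F 0) + L * norm y) * ((exp (a * s) - 1) / a))
        \<le> (norm (F 0) + L * norm y) / a"
      using L by (intro weight s) auto
    finally show ?thesis by simp
  qed
  have Pin: "P y \<in> bcontfun" for y
    by (rule bcontfun_normI[OF contP bddP])
  define \<Phi> where "\<Phi> y = Bcontfun (P y)" for y
  have \<Phi>: "apply_bcontfun (\<Phi> y) = P y" for y
    using Pin by (simp add: \<Phi>_def Bcontfun_inverse)
  have "dist (\<Phi> x) (\<Phi> y) \<le> 1/2 * dist x y" for x y
  proof (rule dist_bound)
    fix t :: real
    define s where "s = max 0 t"
    have s: "0 \<le> s" by (simp add: s_def)
    have fb: "norm (f x r - f y r) \<le> (L * dist x y) * exp (a * r)" if "r \<in> {0..s}" for r
    proof -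
      have "norm (f x r - f y r)
          \<le> L * norm (exp (a * r) *\<^sub>R apply_bcontfun x r - exp (a * r) *\<^sub>R apply_bcontfun y r)"
        unfolding f_def by (rule lipschitz_on_normD[OF F]) auto
      also have "\<dots> = L * (exp (a * r) * dist (apply_bcontfun x r) (apply_bcontfun y r))"
        by (simp add: dist_norm flip: scaleR_diff_right)
      also have "\<dots> \<le> L * (exp (a * r) * dist x y)"
        using L dist_bounded[of x r y] by (auto intro!: mult_left_mono)
      finally show ?thesis by (simp add: algebra_simps)
    qed
    have "norm (integral {0..s} (\<lambda>r. f x r - f y r)) \<le> (L * dist x y) * ((exp (a * s) - 1) / a)"
      using integral_norm_bound_integral[OF integrable_diff[OF intf intf] exp_int(1)[OF s] fb]
        exp_int(2)[OF s] by simp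
    then have "exp (- a * s) * norm (integral {0..s} (\<lambda>r. f x r - f y r))
        \<le> exp (- a * s) * ((L * dist x y) * ((exp (a * s) - 1) / a))"
      by (intro mult_left_mono) auto
    then have "norm (P x t - P y t) \<le> exp (- a * s) * ((L * dist x y) * ((exp (a * s) - 1) / a))"
      unfolding P_def G_def s_def[symmetric] scaleR_diff_right[symmetric]
      by (simp add: integral_diff[OF intf intf])
    also have "\<dots> \<le> (L * dist x y) / a"
      using L by (intro weight s) auto
    also have "\<dots> \<le> 1/2 * dist x y"
      using mult_right_mono[OF a(2), of "dist x y"] by simp
    finally show "dist (apply_bcontfun (\<Phi> x) t) (apply_bcontfun (\<Phi> y) t) \<le> 1/2 * dist x y"
      by (simp add: \<Phi> dist_norm)
  qed
  then obtain y where y: "\<Phi> y = y"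
    using banach_fix_type[of "1/2" \<Phi>] by auto
  have fy: "f y t = F (G y t)" if "0 \<le> t" for t
  proof -
    have "apply_bcontfun y t = exp (- a * t) *\<^sub>R G y t"
      using \<Phi>[of y] that by (simp add: y P_def)
    then show ?thesis unfolding f_def by (simp flip: exp_add)
  qed
  show ?thesis
    by (rule that[of "G y"]) (simp add: G_def, metis derG fy)
qed

section \<open>Differential inequalities and Gronwall estimates on the half-line\<close>

lemma has_real_derivative_inner:
  assumes "(f has_vector_derivative f') (at t within S)" "(g has_vector_derivative g') (at t within S)"
  shows "((\<lambda>t. f t \<bullet> g t) has_real_derivative f t \<bullet> g' + f' \<bullet> g t) (at t within S)"
  using has_derivative_inner[OF assms[unfolded has_vector_derivative_def]]
  by (rule has_derivative_imp_has_field_derivative) (simp add: algebra_simps)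

text \<open>Derivatives are taken within \<open>{0..}\<close> because they are one-sided at 0. The
  horizon \<open>b\<close> allows hypotheses that hold only as long as a bootstrap assumption does;
  where they hold forever, \<open>b\<close> is placed just beyond the last time of interest.\<close>

lemma nonincreasing_on_halfline:
  fixes y :: "real \<Rightarrow> real"
  assumes "\<And>t. 0 \<le> t \<Longrightarrow> t < b \<Longrightarrow> (y has_real_derivative y' t) (at t within {0..})"
    and "\<And>t. 0 \<le> t \<Longrightarrow> t < b \<Longrightarrow> y' t \<le> 0"
    and "0 \<le> s" "s \<le> t" "t < b"
  shows "y t \<le> y s"
proof (rule DERIV_nonpos_imp_decreasing_open[OF \<open>s \<le> t\<close>])
  fix x assume x: "s < x" "x < t"
  have "at x within {0..} = at x"
    using x assms by (intro at_within_interior) auto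
  then show "\<exists>y'. DERIV y x :> y' \<and> y' \<le> 0"
    using assms(1)[of x] assms(2)[of x] x assms(3,5) by (intro exI[of _ "y' x"]) simp
next
  have "continuous (at x within {s..t}) y" if "x \<in> {s..t}" for x
  proof (rule continuous_within_subset)
    show "continuous (at x within {0..}) y"
      using that assms(3,5) by (intro DERIV_continuous[OF assms(1)]) auto
  qed (use that assms(3) in auto)
  then show "continuous_on {s..t} y"
    by (simp add: continuous_on_eq_continuous_within)
qed

text \<open>The integrating factor \<open>exp (c * t)\<close> makes \<open>y t * exp (c * t)\<close>
  nonincreasing. The sign of \<open>c\<close> is free, so a negative \<open>c\<close> gives
  Gronwall's growth bound.\<close>

lemma exponential_decay_on_halfline:
  fixes y :: "real \<Rightarrow> real"
  assumes "\<And>t. 0 \<le> t \<Longrightarrow> t < b \<Longrightarrow> (y has_real_derivative y' t) (at t within {0..})"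
    and "\<And>t. 0 \<le> t \<Longrightarrow> t < b \<Longrightarrow> y' t \<le> - c * y t"
    and "0 \<le> t" "t < b"
  shows "y t \<le> y 0 * exp (- c * t)"
proof -
  have "y t * exp (c * t) \<le> y 0 * exp (c * 0)"
    using assms(3,4)
  proof (rule nonincreasing_on_halfline[where b = b and y = "\<lambda>t. y t * exp (c * t)"
        and y' = "\<lambda>t. (y' t + c * y t) * exp (c * t)", rotated 2, OF order_refl])
    fix t assume t: "0 \<le> t" "t < b"
    show "((\<lambda>t. y t * exp (c * t)) has_real_derivative (y' t + c * y t) * exp (c * t)) (at t within {0..})"
      using assms(1)[OF t] by (auto intro!: derivative_eq_intros simp: algebra_simps)
    show "(y' t + c * y t) * exp (c * t) \<le> 0"
      using assms(2)[OF t] by (simp add: mult_le_0_iff)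
  qed
  then show ?thesis by (simp add: exp_minus field_simps)
qed

text \<open>Gronwall's inequality for the squared distance, which stays differentiable where the
  solutions meet; its derivative is at most \<open>2 * L\<close> times itself.\<close>

lemma lipschitz_ode_dependence:
  fixes F :: "'a::real_inner \<Rightarrow> 'a"
  assumes F: "L-lipschitz_on UNIV F"
    and x: "\<And>t. 0 \<le> t \<Longrightarrow> (x has_vector_derivative F (x t)) (at t within {0..})"
    and y: "\<And>t. 0 \<le> t \<Longrightarrow> (y has_vector_derivative F (y t)) (at t within {0..})"
    and t: "0 \<le> t"
  shows "norm (x t - y t) \<le> exp (L * t) * norm (x 0 - y 0)"
proof -
  define u where "u t = (x t - y t) \<bullet> (x t - y t)" for t
  have u: "u t = (norm (x t - y t))\<^sup>2" for t by (simp add: u_def power2_norm_eq_inner)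
  have "u t \<le> u 0 * exp (- (- (2 * L)) * t)"
  proof (rule exponential_decay_on_halfline[where b = "t + 1"])
    fix s assume s: "0 \<le> (s::real)"
    show "(u has_real_derivative 2 * ((x s - y s) \<bullet> (F (x s) - F (y s)))) (at s within {0..})"
      unfolding u_def
      by (rule DERIV_cong[OF has_real_derivative_inner])
        (auto intro!: has_vector_derivative_diff x y s simp: inner_commute)
    have "(x s - y s) \<bullet> (F (x s) - F (y s)) \<le> norm (x s - y s) * norm (F (x s) - F (y s))"
      by (rule norm_cauchy_schwarz)
    also have "\<dots> \<le> norm (x s - y s) * (L * norm (x s - y s))"
      by (intro mult_left_mono lipschitz_on_normD[OF F]) auto
    finally show "2 * ((x s - y s) \<bullet> (F (x s) - F (y s))) \<le> - (- (2 * L)) * u s"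
      by (simp add: u power2_eq_square algebra_simps)
  qed (use t in auto)
  also have "\<dots> = (exp (L * t) * norm (x 0 - y 0))\<^sup>2"
    by (simp add: u power_mult_distrib power2_eq_square flip: exp_add)
  finally show ?thesis unfolding u
    by (rule power2_le_imp_le) auto
qed

section \<open>Gradients, Hessians and symmetric matrices\<close>

text \<open>The derivative is the inner product with a unique vector, obtained from the adjoint at
  1; this makes the description in \<open>grad\<close> meaningful.\<close>

lemma GDERIV_grad:
  fixes f :: "'a::euclidean_space \<Rightarrow> real"
  assumes "f differentiable (at x)"
  shows "GDERIV f x :> grad f x"
proof -
  obtain f' where f': "(f has_derivative f') (at x)"
    using assms by (auto simp: differentiable_def)
  have "f' = (\<lambda>h. h \<bullet> adjoint f' 1)"
    using adjoint_works[OF has_derivative_linear[OF f'], of _ 1] by auto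
  then have D: "GDERIV f x :> adjoint f' 1"
    using f' by (simp add: gderiv_def)
  have "D' = adjoint f' 1" if "GDERIV f x :> D'" for D'
  proof -
    have "(\<lambda>h. h \<bullet> D') = (\<lambda>h. h \<bullet> adjoint f' 1)"
      using that D unfolding gderiv_def by (rule has_derivative_unique)
    then have "\<forall>h. h \<bullet> D' = h \<bullet> adjoint f' 1" by (simp add: fun_eq_iff)
    then show ?thesis by (simp only: vector_eq_ldot)
  qed
  with D show ?thesis unfolding grad_def by (rule theI)
qed

lemma GDERIV_has_real_derivative_path:
  assumes "GDERIV f (\<gamma> t) :> D" "(\<gamma> has_vector_derivative v) (at t within S)"
  shows "((\<lambda>t. f (\<gamma> t)) has_real_derivative v \<bullet> D) (at t within S)"
  using has_derivative_compose[OF assms(2)[unfolded has_vector_derivative_def] assms(1)[unfolded gderiv_def]]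
  by (rule has_derivative_imp_has_field_derivative) simp

text \<open>The mean value theorem in direction \<open>u\<close> turns the second difference of
  \<open>f\<close> into a difference of two gradients, and differentiability of \<open>g\<close> at
  \<open>a\<close> evaluates that difference up to an error that is small relative to
  \<open>t\<^sup>2\<close>.\<close>

lemma second_difference_estimate:
  assumes f: "\<And>x. GDERIV f x :> g x" and M: "linear M"
    and g: "\<And>h. norm h < \<delta> \<Longrightarrow> norm (g (a + h) - g a - M h) \<le> \<epsilon> * norm h"
    and t: "0 < t" "t * (norm u + norm v) < \<delta>" and "0 \<le> \<epsilon>"
  shows "\<bar>f (a + t *\<^sub>R u + t *\<^sub>R v) - f (a + t *\<^sub>R u) - f (a + t *\<^sub>R v) + f a - t\<^sup>2 * (u \<bullet> M v)\<bar>
    \<le> 2 * \<epsilon> * (t * (norm u + norm v))\<^sup>2"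
proof -
  define \<phi> where "\<phi> s = f (a + t *\<^sub>R v + s *\<^sub>R u) - f (a + s *\<^sub>R u)" for s
  have der: "(\<phi> has_real_derivative u \<bullet> g (a + t *\<^sub>R v + s *\<^sub>R u) - u \<bullet> g (a + s *\<^sub>R u)) (at s)" for s
    unfolding \<phi>_def
    by (intro DERIV_diff GDERIV_has_real_derivative_path f) (auto intro!: derivative_eq_intros)
  obtain s where s: "0 < s" "s < t"
    and eq: "\<phi> t - \<phi> 0 = (t - 0) * (u \<bullet> g (a + t *\<^sub>R v + s *\<^sub>R u) - u \<bullet> g (a + s *\<^sub>R u))"
    using MVT2[OF t(1), of \<phi>, OF der] by blast
  define C where "C = t * (norm u + norm v)"
  define r where "r h = g (a + h) - g a - M h" for h
  have r: "norm (r h) \<le> \<epsilon> * C" if "norm h \<le> C" for h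
  proof -
    have "norm (r h) \<le> \<epsilon> * norm h" unfolding r_def using that t by (intro g) (simp add: C_def)
    also have "\<dots> \<le> \<epsilon> * C" using that \<open>0 \<le> \<epsilon>\<close> by (rule mult_left_mono)
    finally show ?thesis .
  qed
  have n1: "norm (t *\<^sub>R v + s *\<^sub>R u) \<le> C"
  proof -
    have "norm (t *\<^sub>R v + s *\<^sub>R u) \<le> t * norm v + s * norm u"
      using norm_triangle_ineq[of "t *\<^sub>R v" "s *\<^sub>R u"] s t by simp
    also have "s * norm u \<le> t * norm u" using s by (intro mult_right_mono) auto
    finally show ?thesis by (simp add: C_def algebra_simps)
  qed
  have n2: "norm (s *\<^sub>R u) \<le> C"
  proof -
    have "s * norm u \<le> t * norm u" using s by (intro mult_right_mono) auto
    also have "\<dots> \<le> C" using t by (simp add: C_def algebra_simps)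
    finally show ?thesis using s by simp
  qed
  have "\<phi> t - \<phi> 0 - t\<^sup>2 * (u \<bullet> M v) = t * (u \<bullet> (r (t *\<^sub>R v + s *\<^sub>R u) - r (s *\<^sub>R u)))"
    using linear_add[OF M] linear_scale[OF M]
    by (simp add: eq r_def inner_diff_right inner_add_right add.assoc power2_eq_square algebra_simps)
  also have "\<bar>\<dots>\<bar> \<le> t * (norm u * (2 * (\<epsilon> * C)))"
  proof -
    have "norm (r (t *\<^sub>R v + s *\<^sub>R u) - r (s *\<^sub>R u)) \<le> 2 * (\<epsilon> * C)"
      using norm_triangle_ineq4[of "r (t *\<^sub>R v + s *\<^sub>R u)" "r (s *\<^sub>R u)"] r[OF n1] r[OF n2]
      by linarith
    then have "\<bar>u \<bullet> (r (t *\<^sub>R v + s *\<^sub>R u) - r (s *\<^sub>R u))\<bar> \<le> norm u * (2 * (\<epsilon> * C))"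
      by (intro order_trans[OF Cauchy_Schwarz_ineq2] mult_left_mono) auto
    then show ?thesis using t by (simp add: abs_mult)
  qed
  also have "\<dots> = 2 * \<epsilon> * C * (t * norm u)" by simp
  also have "\<dots> \<le> 2 * \<epsilon> * C * C"
    using t \<open>0 \<le> \<epsilon>\<close> by (intro mult_left_mono) (auto simp: C_def algebra_simps)
  finally show ?thesis by (simp add: \<phi>_def C_def power2_eq_square algebra_simps)
qed

text \<open>Swapping \<open>u\<close> and \<open>v\<close> leaves the second difference unchanged,
  so \<open>t\<^sup>2 * (u \<bullet> M v)\<close> and \<open>t\<^sup>2 * (v \<bullet> M u)\<close>
  approximate the same number; dividing by \<open>t\<^sup>2\<close> leaves an arbitrarily small
  error.\<close>

lemma second_derivative_symmetric:
  fixes u v :: "'a::real_inner"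
  assumes f: "\<And>x. GDERIV f x :> g x" and g: "(g has_derivative M) (at a)"
  shows "u \<bullet> M v = v \<bullet> M u"
proof -
  define C where "C = norm u + norm v"
  have C: "0 \<le> C" by (simp add: C_def)
  have "\<bar>u \<bullet> M v - v \<bullet> M u\<bar> \<le> e" if "e > 0" for e
  proof -
    \<comment> \<open>Chosen so that the total error \<open>4 * \<epsilon> * C\<^sup>2\<close> is at
      most \<open>e\<close>; the added 1 covers \<open>C = 0\<close>.\<close>
    define \<epsilon> where "\<epsilon> = e / (4 * (C\<^sup>2 + 1))"
    have \<epsilon>: "\<epsilon> > 0" using that by (simp add: \<epsilon>_def add_nonneg_pos)
    obtain \<delta> where \<delta>: "\<delta> > 0"
      "\<And>y. norm (y - a) < \<delta> \<Longrightarrow> norm (g y - g a - M (y - a)) \<le> \<epsilon> * norm (y - a)"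
      using g \<epsilon> unfolding has_derivative_at_alt by blast
    define t where "t = \<delta> / (C + 1)"
    have t: "t > 0" "t * C < \<delta>" using \<delta>(1) C by (auto simp: t_def field_simps)
    have g': "norm (g (a + h) - g a - M h) \<le> \<epsilon> * norm h" if "norm h < \<delta>" for h
      using \<delta>(2)[of "a + h"] that by simp
    have est: "\<bar>f (a + t *\<^sub>R u + t *\<^sub>R v) - f (a + t *\<^sub>R u) - f (a + t *\<^sub>R v) + f a
        - t\<^sup>2 * (u \<bullet> M v)\<bar> \<le> 2 * \<epsilon> * (t * C)\<^sup>2"
      if uv: "norm u + norm v = C" for u v
      unfolding uv[symmetric]
      by (rule second_difference_estimate[where g = g and \<delta> = \<delta>, OF f has_derivative_linear[OF g] g' t(1)])
        (use t \<epsilon> uv in auto)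
    have "\<bar>t\<^sup>2 * (u \<bullet> M v) - t\<^sup>2 * (v \<bullet> M u)\<bar> \<le> 4 * \<epsilon> * (t * C)\<^sup>2"
      using est[of u v] est[of v u] by (simp add: C_def add.commute add.left_commute)
    moreover have "\<bar>t\<^sup>2 * (u \<bullet> M v) - t\<^sup>2 * (v \<bullet> M u)\<bar> = t\<^sup>2 * \<bar>u \<bullet> M v - v \<bullet> M u\<bar>"
      by (simp add: abs_mult flip: right_diff_distrib)
    ultimately have "t\<^sup>2 * \<bar>u \<bullet> M v - v \<bullet> M u\<bar> \<le> t\<^sup>2 * (4 * \<epsilon> * C\<^sup>2)"
      by (simp add: power_mult_distrib mult_ac)
    then have "\<bar>u \<bullet> M v - v \<bullet> M u\<bar> \<le> 4 * \<epsilon> * C\<^sup>2"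
      using t by (simp add: mult_le_cancel_left)
    also have "\<dots> = e * (C\<^sup>2 / (C\<^sup>2 + 1))"
      using mult_divide_mult_cancel_left[of "4::real" "e * C\<^sup>2" "C\<^sup>2 + 1"] by (simp add: \<epsilon>_def mult.assoc)
    also have "\<dots> \<le> e * 1"
      using that by (intro mult_left_mono) (auto simp: divide_le_eq_1 add_nonneg_pos)
    also have "\<dots> = e" by simp
    finally show ?thesis .
  qed
  then show ?thesis using field_le_epsilon[of "\<bar>u \<bullet> M v - v \<bullet> M u\<bar>" 0] by simp
qed

text \<open>Negative curvature along \<open>u\<close> would make the slope
  \<open>u \<bullet> g (a + s *\<^sub>R u)\<close> negative for small positive \<open>s\<close>, so
  \<open>f\<close> would strictly decrease along this ray.\<close>

lemma second_derivative_nonneg_at_local_min: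
  fixes u :: "'a::real_inner"
  assumes f: "\<And>x. GDERIV f x :> g x" and g: "(g has_derivative M) (at a)" "g a = 0"
    and min: "\<forall>\<^sub>F x in nhds a. f a \<le> f x"
  shows "0 \<le> u \<bullet> M u"
proof (rule ccontr)
  assume neg: "\<not> 0 \<le> u \<bullet> M u"
  have line: "((\<lambda>s. a + s *\<^sub>R u) has_vector_derivative u) (at s)" for s
    by (auto intro!: derivative_eq_intros)
  have "((\<lambda>s. g (a + s *\<^sub>R u)) has_vector_derivative M u) (at 0)"
    using has_derivative_compose[OF line[of 0, unfolded has_vector_derivative_def], of g M] g
    by (simp add: has_vector_derivative_def linear_scale[OF has_derivative_linear[OF g(1)]])
  then have "((\<lambda>s. u \<bullet> g (a + s *\<^sub>R u)) has_real_derivative u \<bullet> M u) (at 0)"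
    using has_real_derivative_inner[OF has_vector_derivative_const] by fastforce
  then obtain d where d: "d > 0" "\<And>h. 0 < h \<Longrightarrow> h < d \<Longrightarrow> u \<bullet> g (a + h *\<^sub>R u) < 0"
    using DERIV_neg_dec_right[of "\<lambda>s. u \<bullet> g (a + s *\<^sub>R u)" "u \<bullet> M u" 0] neg g(2) by auto
  have der: "((\<lambda>s. f (a + s *\<^sub>R u)) has_real_derivative u \<bullet> g (a + s *\<^sub>R u)) (at s)" for s
    by (rule GDERIV_has_real_derivative_path[OF f line])
  have dec: "f (a + h *\<^sub>R u) < f a" if "0 < h" "h < d" for h
  proof -
    have "f (a + h *\<^sub>R u) < f (a + 0 *\<^sub>R u)"
    proof (rule DERIV_neg_imp_decreasing_open[OF that(1)])
      show "\<exists>y. ((\<lambda>s. f (a + s *\<^sub>R u)) has_real_derivative y) (at s) \<and> y < 0" if "0 < s" "s < h" for s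
        using der d(2)[of s] that \<open>h < d\<close> by auto
      show "continuous_on {0..h} (\<lambda>s. f (a + s *\<^sub>R u))"
        using der by (meson DERIV_isCont continuous_at_imp_continuous_on)
    qed
    then show ?thesis by simp
  qed
  have "((\<lambda>h. a + h *\<^sub>R u) \<longlongrightarrow> a + 0 *\<^sub>R u) (at_right (0::real))"
    by (intro tendsto_intros)
  then have "\<forall>\<^sub>F h in at_right 0. f a \<le> f (a + h *\<^sub>R u)"
    using min by (auto elim: eventually_compose_filterlim)
  moreover have "\<forall>\<^sub>F h in at_right 0. h < d"
    using d(1) by (auto simp: eventually_at_right_field)
  ultimately have "\<forall>\<^sub>F h in at_right (0::real). False"
    using eventually_at_right_less[of 0] by eventually_elim (use dec in force)
  then show False by simp
qed

text \<open>The Rayleigh quotient attains its minimum on the unit sphere, and its first-order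
  condition at the minimizer is the eigenvalue equation.\<close>

lemma symmetric_matrix_min_eigenvalue:
  fixes M :: "real^'n^'n"
  assumes sym: "\<And>u v. u \<bullet> (M *v v) = v \<bullet> (M *v u)"
  obtains \<mu> where "\<mu> \<in> eigenvalues M" "\<And>x. \<mu> * (norm x)\<^sup>2 \<le> x \<bullet> (M *v x)"
proof -
  obtain b :: "real^'n" where b: "norm b = 1"
    using vector_choose_size[of 1] by auto
  have "continuous_on (sphere 0 1) (\<lambda>x. x \<bullet> (M *v x))"
    by (intro continuous_intros linear_continuous_on matrix_vector_mul_bounded_linear)
  then obtain w where w: "norm w = 1" "\<And>x. norm x = 1 \<Longrightarrow> w \<bullet> (M *v w) \<le> x \<bullet> (M *v x)"
    using continuous_attains_inf[of "sphere 0 1" "\<lambda>x. x \<bullet> (M *v x)"] b by fastforce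
  define \<mu> where "\<mu> = w \<bullet> (M *v w)"
  have low: "\<mu> * (norm x)\<^sup>2 \<le> x \<bullet> (M *v x)" for x
  proof (cases "x = 0")
    case False
    have "\<mu> \<le> (x /\<^sub>R norm x) \<bullet> (M *v (x /\<^sub>R norm x))"
      unfolding \<mu>_def using False by (intro w) simp
    also have "\<dots> = (x \<bullet> (M *v x)) / (norm x)\<^sup>2"
      by (simp add: matrix_vector_mult_scaleR power2_eq_square field_simps)
    finally show ?thesis using False by (simp add: field_simps)
  qed simp
  have zero: "v \<bullet> (M *v w - \<mu> *\<^sub>R w) = 0" for v
  proof -
    define B where "B = v \<bullet> (M *v w - \<mu> *\<^sub>R w)"
    define A where "A = v \<bullet> (M *v v) - \<mu> * (v \<bullet> v)"
    have quad: "0 \<le> 2 * t * B + t\<^sup>2 * A" for t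
    proof -
      have "\<mu> * ((w + t *\<^sub>R v) \<bullet> (w + t *\<^sub>R v)) \<le> (w + t *\<^sub>R v) \<bullet> (M *v (w + t *\<^sub>R v))"
        using low[of "w + t *\<^sub>R v"] by (simp add: power2_norm_eq_inner)
      moreover have "w \<bullet> w = 1" using w by (simp add: dot_square_norm)
      ultimately show ?thesis
        using sym[of w v]
        by (simp add: A_def B_def \<mu>_def matrix_vector_right_distrib matrix_vector_mult_scaleR
            inner_add_left inner_add_right inner_diff_right power2_eq_square inner_commute algebra_simps)
    qed
    show ?thesis
    proof (rule ccontr)
      assume "v \<bullet> (M *v w - \<mu> *\<^sub>R w) \<noteq> 0"
      then have B: "B \<noteq> 0" by (simp add: B_def)
      \<comment> \<open>The minimizer of \<open>2 * t * B + t\<^sup>2 * (\<bar>A\<bar> + 1)\<close>,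
        a quadratic that dominates the given one and has positive leading coefficient.\<close>
      define t where "t = - B / (\<bar>A\<bar> + 1)"
      have "2 * t * B + t\<^sup>2 * A \<le> 2 * t * B + t\<^sup>2 * (\<bar>A\<bar> + 1)"
        by (intro add_left_mono mult_left_mono) auto
      also have "\<dots> = - B\<^sup>2 / (\<bar>A\<bar> + 1)"
        by (simp add: t_def power2_eq_square divide_simps)
      also have "\<dots> < 0" using B by (simp add: divide_neg_pos)
      finally show False using quad[of t] by simp
    qed
  qed
  from zero[of "M *v w - \<mu> *\<^sub>R w"] have "M *v w = \<mu> *\<^sub>R w"
    by simp
  then have "\<mu> \<in> eigenvalues M"
    using w(1) by (auto simp: eigenvalues_def intro!: exI[of _ w])
  from this low show ?thesis by (rule that)
qed

text \<open>Eigenvectors for distinct eigenvalues are orthogonal, hence independent. Finiteness is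
  what gives \<open>Min\<close> in \<open>min_curvature\<close> its meaning.\<close>

lemma symmetric_matrix_finite_eigenvalues:
  fixes M :: "real^'n^'n"
  assumes sym: "\<And>u v. u \<bullet> (M *v v) = v \<bullet> (M *v u)"
  shows "finite (eigenvalues M)"
proof -
  define e where "e h = (SOME v. v \<noteq> 0 \<and> M *v v = h *\<^sub>R v)" for h
  have e: "e h \<noteq> 0" "M *v e h = h *\<^sub>R e h" if "h \<in> eigenvalues M" for h
    using someI_ex[of "\<lambda>v. v \<noteq> 0 \<and> M *v v = h *\<^sub>R v"] that
    by (auto simp: eigenvalues_def e_def)
  have orth: "e h \<bullet> e k = 0" if "h \<in> eigenvalues M" "k \<in> eigenvalues M" "h \<noteq> k" for h k
    using sym[of "e h" "e k"] e that by (simp add: inner_commute)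
  have inj: "inj_on e (eigenvalues M)"
    by (rule inj_onI) (metis e(1) orth inner_eq_zero_iff)
  have "pairwise orthogonal (e ` eigenvalues M)"
    using orth by (force simp: pairwise_def orthogonal_def)
  then have "independent (e ` eigenvalues M)"
    using e(1) by (intro pairwise_orthogonal_independent) auto
  then have "finite (e ` eigenvalues M)"
    by (rule independent_imp_finite)
  then show ?thesis using inj by (rule finite_imageD)
qed

section \<open>The flow and its energy\<close>

text \<open>At the first time where \<open>h\<close> reaches \<open>R\<close>, continuity would pass
  on the improved bound \<open>R' < R\<close> valid before it. This makes estimates that hold only
  inside a ball hold for all time.\<close>

lemma bounded_by_first_exit:
  fixes h :: "real \<Rightarrow> real"
  assumes cont: "continuous_on {0..} h" and "h 0 < R" "R' < R"
    and step: "\<And>b t. (\<And>s. 0 \<le> s \<Longrightarrow> s < b \<Longrightarrow> h s < R) \<Longrightarrow> 0 \<le> t \<Longrightarrow> t < b \<Longrightarrow> h t \<le> R'"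
    and "0 \<le> t"
  shows "h t < R"
proof (rule ccontr)
  assume "\<not> h t < R"
  define S where "S = {t \<in> {0..}. R \<le> h t}"
  have "closed ({0..} \<inter> h -` {R..})"
    by (intro continuous_closed_preimage cont) auto
  moreover have "{0..} \<inter> h -` {R..} = S" by (auto simp: S_def)
  ultimately have S: "S \<noteq> {}" "bdd_below S" "closed S"
    using \<open>0 \<le> t\<close> \<open>\<not> h t < R\<close> by (auto simp: S_def bdd_below_def)
  define \<tau> where "\<tau> = Inf S"
  have "\<tau> \<in> S" unfolding \<tau>_def by (rule closed_contains_Inf[OF S])
  then have \<tau>: "0 < \<tau>" "R \<le> h \<tau>"
    using \<open>h 0 < R\<close> by (cases "\<tau> = 0"; auto simp: S_def)+
  have below: "h s < R" if "0 \<le> s" "s < \<tau>" for s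
    using that cInf_lower[OF _ S(2), of s] by (force simp: S_def \<tau>_def)
  have "- R' \<le> - h \<tau>"
  proof (rule continuous_ge_on_Ioo[of 0 \<tau> "\<lambda>s. - h s"])
    show "continuous_on {0..\<tau>} (\<lambda>s. - h s)"
      using cont by (intro continuous_on_minus) (rule continuous_on_subset, auto)
    show "- R' \<le> - h s" if "s \<in> {0<..<\<tau>}" for s
      using step[OF below] that by auto
  qed (use \<tau>(1) in auto)
  then show False using \<tau> \<open>R' < R\<close> by simp
qed

text \<open>Difference quotients along \<open>u\<close> have norm at most \<open>l * norm u\<close>,
  and so does their limit. Applied to \<open>grad f\<close>, this bounds every Hessian.\<close>

lemma lipschitz_derivative_bound:
  assumes g: "(g has_derivative M) (at x)" and lip: "l-lipschitz_on UNIV g"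
  shows "norm (M u) \<le> l * norm u"
proof (rule field_le_epsilon)
  fix e :: real assume "e > 0"
  define \<epsilon> where "\<epsilon> = e / (norm u + 1)"
  have nu: "norm u + 1 > 0" by (simp add: add_nonneg_pos)
  have \<epsilon>: "\<epsilon> > 0" "\<epsilon> * norm u \<le> e"
    using \<open>e > 0\<close> nu by (auto simp: \<epsilon>_def pos_divide_le_eq)
  obtain \<delta> where \<delta>: "\<delta> > 0"
    "\<And>y. norm (y - x) < \<delta> \<Longrightarrow> norm (g y - g x - M (y - x)) \<le> \<epsilon> * norm (y - x)"
    using g \<epsilon>(1) unfolding has_derivative_at_alt by blast
  define s where "s = \<delta> / (norm u + 1)"
  have s: "s > 0" "s * norm u < \<delta>"
    using \<delta>(1) nu by (auto simp: s_def pos_divide_less_eq)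
  have "norm (g (x + s *\<^sub>R u) - g x - s *\<^sub>R M u) \<le> \<epsilon> * (s * norm u)"
    using \<delta>(2)[of "x + s *\<^sub>R u"] s by (simp add: linear_scale[OF has_derivative_linear[OF g]])
  moreover have "norm (g (x + s *\<^sub>R u) - g x) \<le> l * (s * norm u)"
    using lipschitz_on_normD[OF lip, of "x + s *\<^sub>R u" x] s by simp
  moreover have "norm (s *\<^sub>R M u)
      \<le> norm (g (x + s *\<^sub>R u) - g x) + norm (g (x + s *\<^sub>R u) - g x - s *\<^sub>R M u)"
    using norm_triangle_ineq4[of "g (x + s *\<^sub>R u) - g x" "g (x + s *\<^sub>R u) - g x - s *\<^sub>R M u"]
    by simp
  ultimately have "s * norm (M u) \<le> s * (l * norm u + \<epsilon> * norm u)"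
    using s by (simp add: algebra_simps)
  then show "norm (M u) \<le> l * norm u + e"
    using s \<epsilon>(2) by (simp add: mult_le_cancel_left)
qed

text \<open>One function at one parameter value. \<open>hessian_lower\<close> is the lower bound
  \<open>1 / \<kappa>\<close> for the spectrum at the origin, and \<open>\<beta>_bound\<close>
  unites both cases: it says \<open>\<beta> < 2 * d / Cf\<close> for positive \<open>Cf\<close> and
  \<open>0 < d\<close> for \<open>Cf = 0\<close>.\<close>

locale momentum_flow =
  fixes f :: "real^'n \<Rightarrow> real" and d \<beta> Cf \<kappa> l :: real
  assumes f_diff: "\<And>x. f differentiable (at x)"
    and grad_lipschitz: "l-lipschitz_on UNIV (grad f)"
    and grad_diff: "\<And>x. grad f differentiable (at x)"
    and curvature: "\<And>u x. - Cf * (norm u)\<^sup>2 \<le> u \<bullet> (hessian f x *v u)"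
    and f_0: "f 0 = 0" and f_local_min: "\<forall>\<^sub>F x in nhds 0. 0 \<le> f x"
    and hessian_lower: "\<And>x. (norm x)\<^sup>2 \<le> \<kappa> * (x \<bullet> (hessian f 0 *v x))"
    and \<kappa>_ge_1: "1 \<le> \<kappa>" and d_pos: "0 < d" and \<beta>_nonneg: "0 \<le> \<beta>" and \<beta>_bound: "Cf * \<beta> < 2 * d"
begin

abbreviation "\<phi> \<equiv> flow d \<beta> f"
abbreviation "H \<equiv> hamiltonian f"
abbreviation "Q \<equiv> hessian f 0"

section \<open>Derivatives of \<open>f\<close>, and the origin as a critical point\<close>

lemma GDERIV_f: "GDERIV f x :> grad f x"
  by (rule GDERIV_grad[OF f_diff])

lemma grad_has_derivative: "(grad f has_derivative (\<lambda>h. hessian f x *v h)) (at x)"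
  using grad_diff[of x] unfolding hessian_def jacobian_works .

lemma grad_0: "grad f 0 = 0"
proof -
  have "(\<lambda>h. h \<bullet> grad f 0) = (\<lambda>h. 0)"
    using GDERIV_f[of 0] f_local_min f_0
    unfolding gderiv_def by (intro has_derivative_local_min[of f _ 0]) (auto simp: eventually_nhds_conv_at)
  then show ?thesis by (metis inner_eq_zero_iff)
qed

lemma hessian_symmetric: "u \<bullet> (Q *v v) = v \<bullet> (Q *v u)"
  by (rule second_derivative_symmetric[OF GDERIV_f grad_has_derivative])

lemma hessian_nonneg: "0 \<le> x \<bullet> (Q *v x)"
  using hessian_lower[of x] \<kappa>_ge_1 by (smt (verit) mult_pos_neg zero_le_power2)

lemma l_nonneg: "0 \<le> l"
  by (rule lipschitz_on_nonneg[OF grad_lipschitz])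

section \<open>Well-posedness and semigroup property of the flow\<close>

lemma vector_field_lipschitz:
  obtains L where "L-lipschitz_on UNIV (vector_field d \<beta> f)"
proof -
  have fst: "1-lipschitz_on UNIV (fst :: (real^'n) \<times> (real^'n) \<Rightarrow> _)"
    and snd: "1-lipschitz_on UNIV (snd :: (real^'n) \<times> (real^'n) \<Rightarrow> _)"
    by (intro lipschitz_onI; simp add: dist_fst_le dist_snd_le)+
  have g: "(l * (1 + \<bar>\<beta>\<bar> * 1))-lipschitz_on UNIV (\<lambda>z. grad f (fst z + \<beta> *\<^sub>R snd z))"
    by (intro lipschitz_on_compose2[where g = "grad f"]
        lipschitz_on_subset[OF grad_lipschitz] lipschitz_on_add lipschitz_on_cmult fst snd) auto
  have "vector_field d \<beta> f = (\<lambda>z. (snd z, (- (2 * d)) *\<^sub>R snd z - grad f (fst z + \<beta> *\<^sub>R snd z)))"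
    by (auto simp: vector_field_def fun_eq_iff)
  moreover have "\<exists>L. L-lipschitz_on UNIV
      (\<lambda>z. (snd z, (- (2 * d)) *\<^sub>R snd z - grad f (fst z + \<beta> *\<^sub>R snd z)))"
    by (rule exI, rule lipschitz_on_Pair[OF snd], rule lipschitz_on_diff[OF _ g], rule lipschitz_on_cmult[OF snd])
  ultimately show ?thesis using that by auto
qed

text \<open>A fixed Lipschitz constant of the vector field. It may depend on \<open>f\<close> and
  the parameters, since it enters only the prefactor of the final estimate, not the rate.\<close>

definition "L = (SOME L. L-lipschitz_on UNIV (vector_field d \<beta> f))"

lemma L_lipschitz: "L-lipschitz_on UNIV (vector_field d \<beta> f)"
  unfolding L_def by (rule someI_ex) (meson vector_field_lipschitz)

lemma L_nonneg: "0 \<le> L"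
  by (rule lipschitz_on_nonneg[OF L_lipschitz])

lemma trajectory_dependence:
  assumes "trajectory d \<beta> f x" "trajectory d \<beta> f y" "0 \<le> t"
  shows "norm (x t - y t) \<le> exp (L * t) * norm (x 0 - y 0)"
  using assms unfolding trajectory_def
  by (intro lipschitz_ode_dependence[OF L_lipschitz]) auto

text \<open>The dependence estimate at initial distance zero is uniqueness, so the description in
  \<open>flow\<close> picks out the value of any known trajectory.\<close>

lemma flow_eq:
  assumes "trajectory d \<beta> f z" "0 \<le> t"
  shows "\<phi> t (z 0) = z t"
  unfolding flow_def
proof (rule the_equality)
  fix w assume "\<exists>y. trajectory d \<beta> f y \<and> y 0 = z 0 \<and> y t = w"
  then show "w = z t"
    using trajectory_dependence[OF _ assms(1,2)] by fastforce
qed (use assms in blast)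

lemma flow_0 [simp]: "\<phi> 0 z = z"
  and trajectory_flow: "trajectory d \<beta> f (\<lambda>t. \<phi> t z)"
proof -
  obtain y where y: "y 0 = z" "trajectory d \<beta> f y"
    using lipschitz_ode_solution_exists[OF L_lipschitz, of z] unfolding trajectory_def by metis
  have eq: "\<phi> t z = y t" if "0 \<le> t" for t
    using flow_eq[OF y(2) that] y(1) by simp
  then show "\<phi> 0 z = z" using y by simp
  show "trajectory d \<beta> f (\<lambda>t. \<phi> t z)"
    using y(2) unfolding trajectory_def
    by (auto simp: eq intro: has_vector_derivative_transform[of _ "{0..}" "\<lambda>t. \<phi> t z" y])
qed

text \<open>The vector field is autonomous, so a time-shifted trajectory is again a trajectory, and
  uniqueness identifies it.\<close>

lemma flow_add:
  assumes "0 \<le> s" "0 \<le> t"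
  shows "\<phi> t (\<phi> s z) = \<phi> (s + t) z"
proof -
  have "trajectory d \<beta> f (\<lambda>t. \<phi> (s + t) z)"
    unfolding trajectory_def
  proof safe
    fix t :: real assume "0 \<le> t"
    then have "((\<lambda>t. \<phi> t z) has_vector_derivative vector_field d \<beta> f (\<phi> (s + t) z)) (at (s + t) within {0..})"
      using trajectory_flow[of z] assms unfolding trajectory_def by auto
    then have *: "((\<lambda>t. \<phi> t z) has_vector_derivative vector_field d \<beta> f (\<phi> (s + t) z))
        (at (s + t) within (\<lambda>t. s + t) ` {0..})"
      by (rule has_vector_derivative_within_subset) (use assms in auto)
    have "((\<lambda>t. s + t) has_vector_derivative 1) (at t within {0..})"
      by (auto intro!: derivative_eq_intros)
    from vector_diff_chain_within[OF this *]
    show "((\<lambda>t. \<phi> (s + t) z) has_vector_derivative vector_field d \<beta> f (\<phi> (s + t) z)) (at t within {0..})"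
      by (simp add: o_def)
  qed
  from flow_eq[OF this assms(2)] show ?thesis by simp
qed

lemma flow_dependence: "0 \<le> t \<Longrightarrow> norm (\<phi> t x - \<phi> t y) \<le> exp (L * t) * norm (x - y)"
  using trajectory_dependence[OF trajectory_flow trajectory_flow, of t x y] by simp

lemma flow_origin: "0 \<le> t \<Longrightarrow> \<phi> t 0 = 0"
  by (rule flow_eq[of "\<lambda>_. 0"])
    (simp_all add: trajectory_def vector_field_def grad_0 zero_prod_def[symmetric] case_prod_beta)

lemma norm_flow_le: "0 \<le> t \<Longrightarrow> norm (\<phi> t x) \<le> exp (L * t) * norm x"
  using flow_dependence[of t x 0] by (simp add: flow_origin)

lemma continuous_flow: "0 \<le> t \<Longrightarrow> continuous_on UNIV (\<phi> t)"
  by (rule lipschitz_on_continuous_on[of "exp (L * t)"])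
    (intro lipschitz_onI; simp add: dist_norm flow_dependence)

lemma continuous_trajectory: "trajectory d \<beta> f z \<Longrightarrow> continuous_on {0..} z"
  unfolding trajectory_def continuous_on_eq_continuous_within
  by (auto intro: has_vector_derivative_continuous)

section \<open>Dissipation of energy along trajectories\<close>

lemma trajectory_position:
  assumes "trajectory d \<beta> f z" "0 \<le> t"
  shows "((\<lambda>t. fst (z t)) has_vector_derivative snd (z t)) (at t within {0..})"
  using bounded_linear.has_vector_derivative[OF bounded_linear_fst, of z] assms
  unfolding trajectory_def vector_field_def by (fastforce simp: case_prod_beta)

lemma trajectory_momentum:
  assumes "trajectory d \<beta> f z" "0 \<le> t"
  shows "((\<lambda>t. snd (z t)) has_vector_derivative
    - (2 * d) *\<^sub>R snd (z t) - grad f (fst (z t) + \<beta> *\<^sub>R snd (z t))) (at t within {0..})"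
  using bounded_linear.has_vector_derivative[OF bounded_linear_snd, of z] assms
  unfolding trajectory_def vector_field_def by (fastforce simp: case_prod_beta)

text \<open>Integration of the lower curvature bound along the segment from \<open>q\<close> to
  \<open>q + \<beta> *\<^sub>R p\<close>; this is the price of evaluating the gradient at the
  shifted point.\<close>

lemma grad_increment_lower: "- (Cf * \<beta>) * (norm p)\<^sup>2 \<le> p \<bullet> (grad f (q + \<beta> *\<^sub>R p) - grad f q)"
proof -
  have "- (p \<bullet> grad f (q + \<beta> *\<^sub>R p)) - Cf * (norm p)\<^sup>2 * \<beta>
      \<le> - (p \<bullet> grad f (q + 0 *\<^sub>R p)) - Cf * (norm p)\<^sup>2 * 0"
  proof (rule nonincreasing_on_halfline[where b = "\<beta> + 1"
        and y = "\<lambda>s. - (p \<bullet> grad f (q + s *\<^sub>R p)) - Cf * (norm p)\<^sup>2 * s"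
        and y' = "\<lambda>s. - (p \<bullet> (hessian f (q + s *\<^sub>R p) *v p)) - Cf * (norm p)\<^sup>2"])
    fix s :: real
    have line: "((\<lambda>s. q + s *\<^sub>R p) has_vector_derivative p) (at s within {0..})"
      by (auto intro!: derivative_eq_intros)
    have "((\<lambda>s. grad f (q + s *\<^sub>R p)) has_vector_derivative hessian f (q + s *\<^sub>R p) *v p) (at s within {0..})"
      using has_derivative_compose[OF line[unfolded has_vector_derivative_def] grad_has_derivative]
      by (simp add: has_vector_derivative_def matrix_vector_mult_scaleR)
    from has_real_derivative_inner[OF has_vector_derivative_const[of p] this]
    show "((\<lambda>s. - (p \<bullet> grad f (q + s *\<^sub>R p)) - Cf * (norm p)\<^sup>2 * s) has_real_derivative
        - (p \<bullet> (hessian f (q + s *\<^sub>R p) *v p)) - Cf * (norm p)\<^sup>2) (at s within {0..})"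
      by (auto intro!: derivative_eq_intros)
    show "- (p \<bullet> (hessian f (q + s *\<^sub>R p) *v p)) - Cf * (norm p)\<^sup>2 \<le> 0"
      using curvature[of p "q + s *\<^sub>R p"] by simp
  qed (use \<beta>_nonneg in auto)
  then show ?thesis by (simp add: inner_diff_right algebra_simps)
qed

lemma hamiltonian_eq: "H z = snd z \<bullet> snd z / 2 + f (fst z)"
  by (simp add: hamiltonian_def case_prod_beta power2_norm_eq_inner)

lemma continuous_f: "continuous_on S f"
  using f_diff by (meson differentiable_imp_continuous_within continuous_at_imp_continuous_on)

lemma continuous_grad: "continuous_on S (grad f)"
  using lipschitz_on_continuous_on[OF grad_lipschitz] continuous_on_subset by blast

lemma continuous_hamiltonian: "continuous_on S H"
  unfolding hamiltonian_eq
  by (intro continuous_intros continuous_on_compose2[OF continuous_f]) auto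

text \<open>The power \<open>p \<bullet> grad f q\<close> cancels between kinetic and potential
  energy. What remains is friction and the gradient increment due to the shift, which is at most
  \<open>Cf * \<beta>\<close> times the squared momentum.\<close>

lemma hamiltonian_derivative:
  assumes "trajectory d \<beta> f z" "0 \<le> t"
  obtains D where "((\<lambda>t. H (z t)) has_real_derivative D) (at t within {0..})"
    and "D \<le> - (2 * d - Cf * \<beta>) * (norm (snd (z t)))\<^sup>2"
proof -
  let ?q = "fst (z t)" and ?p = "snd (z t)"
  let ?D = "- (2 * d) * (?p \<bullet> ?p) - ?p \<bullet> (grad f (?q + \<beta> *\<^sub>R ?p) - grad f ?q)"
  have "((\<lambda>t. snd (z t) \<bullet> snd (z t) / 2 + f (fst (z t))) has_real_derivative
      (?p \<bullet> (- (2 * d) *\<^sub>R ?p - grad f (?q + \<beta> *\<^sub>R ?p))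
        + (- (2 * d) *\<^sub>R ?p - grad f (?q + \<beta> *\<^sub>R ?p)) \<bullet> ?p) / 2 + ?p \<bullet> grad f ?q) (at t within {0..})"
    by (intro DERIV_add DERIV_cdivide has_real_derivative_inner GDERIV_has_real_derivative_path
        GDERIV_f trajectory_position trajectory_momentum assms)
  then have "((\<lambda>t. H (z t)) has_real_derivative ?D) (at t within {0..})"
    unfolding hamiltonian_eq
    by (rule DERIV_cong) (simp add: inner_diff_right inner_diff_left inner_commute field_simps)
  moreover have "?D \<le> - (2 * d - Cf * \<beta>) * (norm ?p)\<^sup>2"
    using grad_increment_lower[of ?p ?q] by (simp add: power2_norm_eq_inner algebra_simps)
  ultimately show ?thesis by (rule that)
qed

lemma hamiltonian_nonincreasing:
  assumes "trajectory d \<beta> f z" "0 \<le> s" "s \<le> t"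
  shows "H (z t) \<le> H (z s)"
proof -
  have "\<exists>D. ((\<lambda>t. H (z t)) has_real_derivative D) (at t within {0..}) \<and> D \<le> 0"
    if t: "0 \<le> t" for t
  proof -
    obtain D where "((\<lambda>t. H (z t)) has_real_derivative D) (at t within {0..})"
      "D \<le> - (2 * d - Cf * \<beta>) * (norm (snd (z t)))\<^sup>2"
      using hamiltonian_derivative[OF assms(1) t] .
    moreover have "0 \<le> (2 * d - Cf * \<beta>) * (norm (snd (z t)))\<^sup>2"
      using \<beta>_bound by simp
    ultimately show ?thesis by (intro exI[of _ D]) linarith
  qed
  then obtain D where "\<And>t. 0 \<le> t \<Longrightarrow> ((\<lambda>t. H (z t)) has_real_derivative D t) (at t within {0..}) \<and> D t \<le> 0"
    by metis
  then show ?thesis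
    using assms by (intro nonincreasing_on_halfline[of "t + 1" "\<lambda>t. H (z t)" D]) auto
qed

text \<open>\<open>H\<close> alone is not a strict Lyapunov function, as its derivative vanishes wherever \<open>p = 0\<close>; a small
  multiple of \<open>p \<bullet> grad f q\<close> repairs this and replaces an invariance argument in the style of LaSalle.\<close>

definition "V \<epsilon> w = H w + \<epsilon> * (snd w \<bullet> grad f (fst w))"
definition "N w = (norm (snd w))\<^sup>2 + (norm (grad f (fst w)))\<^sup>2"

text \<open>The added term contributes minus the squared gradient times
  \<open>\<epsilon> / 2\<close> after Young's inequality; its remaining contributions are of order
  \<open>\<epsilon>\<close> in the squared momentum and are absorbed by friction. \<open>N\<close>
  vanishes exactly at the equilibria, and \<open>m\<close> and \<open>\<epsilon>\<close> are the
  same for all trajectories.\<close>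

lemma strict_lyapunov_function:
  "\<exists>m>0. \<exists>\<epsilon>. \<forall>z t. trajectory d \<beta> f z \<longrightarrow> 0 \<le> t \<longrightarrow>
    (\<exists>D. ((\<lambda>t. V \<epsilon> (z t)) has_real_derivative D) (at t within {0..}) \<and> D \<le> - m * N (z t))"
proof -
  define a where "a = 2 * d - Cf * \<beta>"
  define k where "k = 2 * d + l * \<beta>"
  \<comment> \<open>This choice makes \<open>\<epsilon> * (k\<^sup>2 / 2 + l)\<close> equal to
    \<open>(a - \<epsilon>) / 2\<close>, so that more than half of the friction \<open>a\<close>
    survives. Here \<open>k * norm p\<close> bounds the part of the force that vanishes with
    \<open>p\<close>.\<close>
  define \<epsilon> where "\<epsilon> = a / (k\<^sup>2 + 2 * l + 1)"
  have a: "a > 0" using \<beta>_bound by (simp add: a_def)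
  have den: "k\<^sup>2 + 2 * l + 1 > 0" using l_nonneg by (simp add: add_nonneg_pos)
  have \<epsilon>: "\<epsilon> > 0" using a den by (simp add: \<epsilon>_def)
  have \<epsilon>_eq: "\<epsilon> * (k\<^sup>2 / 2 + l) = (a - \<epsilon>) / 2"
  proof -
    have "\<epsilon> * (k\<^sup>2 + 2 * l + 1) = a" using den by (simp add: \<epsilon>_def)
    then show ?thesis by (simp add: algebra_simps)
  qed
  define m where "m = min a \<epsilon> / 2"
  have m: "0 < m" "m \<le> a / 2" "m \<le> \<epsilon> / 2" using a \<epsilon> by (auto simp: m_def)
  show ?thesis
  proof (rule exI[of _ m], rule conjI[OF m(1)], rule exI[of _ \<epsilon>], intro allI impI)
    fix z t assume z: "trajectory d \<beta> f z" "0 \<le> (t::real)"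
    let ?q = "fst (z t)" and ?p = "snd (z t)"
    let ?g = "grad f ?q" and ?p' = "- (2 * d) *\<^sub>R snd (z t) - grad f (fst (z t) + \<beta> *\<^sub>R snd (z t))"
    obtain D where D: "((\<lambda>t. H (z t)) has_real_derivative D) (at t within {0..})"
      "D \<le> - a * (norm ?p)\<^sup>2"
      using hamiltonian_derivative[OF z] unfolding a_def .
    have gpath: "((\<lambda>t. grad f (fst (z t))) has_vector_derivative hessian f ?q *v ?p) (at t within {0..})"
      using has_derivative_compose[OF trajectory_position[OF z, unfolded has_vector_derivative_def]
          grad_has_derivative]
      by (simp add: has_vector_derivative_def matrix_vector_mult_scaleR)
    define D' where "D' = D + \<epsilon> * (?p \<bullet> (hessian f ?q *v ?p) + ?p' \<bullet> ?g)"
    have "((\<lambda>t. V \<epsilon> (z t)) has_real_derivative D') (at t within {0..})"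
      unfolding D'_def V_def
      by (intro DERIV_add D(1) DERIV_cmult has_real_derivative_inner gpath trajectory_momentum z)
    moreover have "D' \<le> - m * ((norm ?p)\<^sup>2 + (norm ?g)\<^sup>2)"
    proof -
      have "?p \<bullet> (hessian f ?q *v ?p) \<le> norm ?p * norm (hessian f ?q *v ?p)"
        by (rule norm_cauchy_schwarz)
      also have "\<dots> \<le> norm ?p * (l * norm ?p)"
        by (intro mult_left_mono lipschitz_derivative_bound[OF grad_has_derivative grad_lipschitz]) auto
      finally have hess: "?p \<bullet> (hessian f ?q *v ?p) \<le> l * (norm ?p)\<^sup>2"
        by (simp add: power2_eq_square mult_ac)
      have "norm (- (2 * d) *\<^sub>R ?p - (grad f (?q + \<beta> *\<^sub>R ?p) - ?g)) \<le> 2 * d * norm ?p + l * (\<beta> * norm ?p)"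
        using norm_triangle_ineq4[of "- (2 * d) *\<^sub>R ?p" "grad f (?q + \<beta> *\<^sub>R ?p) - ?g"]
          lipschitz_on_normD[OF grad_lipschitz, of "?q + \<beta> *\<^sub>R ?p" ?q] d_pos \<beta>_nonneg
        by simp
      then have "(- (2 * d) *\<^sub>R ?p - (grad f (?q + \<beta> *\<^sub>R ?p) - ?g)) \<bullet> ?g \<le> (k * norm ?p) * norm ?g"
        by (intro order_trans[OF norm_cauchy_schwarz] mult_right_mono) (auto simp: k_def algebra_simps)
      also have "\<dots> \<le> k\<^sup>2 / 2 * (norm ?p)\<^sup>2 + (norm ?g)\<^sup>2 / 2"
        using sum_squares_bound[of "k * norm ?p" "norm ?g"] by (simp add: power_mult_distrib)
      finally have "?p' \<bullet> ?g \<le> k\<^sup>2 / 2 * (norm ?p)\<^sup>2 - (norm ?g)\<^sup>2 / 2"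
        by (simp add: inner_diff_left power2_norm_eq_inner)
      then have "\<epsilon> * (?p \<bullet> (hessian f ?q *v ?p) + ?p' \<bullet> ?g)
          \<le> \<epsilon> * (l * (norm ?p)\<^sup>2 + (k\<^sup>2 / 2 * (norm ?p)\<^sup>2 - (norm ?g)\<^sup>2 / 2))"
        using hess \<epsilon> by (intro mult_left_mono add_mono) auto
      also have "\<dots> = (\<epsilon> * (k\<^sup>2 / 2 + l)) * (norm ?p)\<^sup>2 - \<epsilon> / 2 * (norm ?g)\<^sup>2"
        by (simp add: algebra_simps)
      finally have "D' \<le> - ((a + \<epsilon>) / 2) * (norm ?p)\<^sup>2 - \<epsilon> / 2 * (norm ?g)\<^sup>2"
        unfolding D'_def \<epsilon>_eq using D(2) by (simp add: field_simps)
      moreover have "m * (norm ?p)\<^sup>2 \<le> ((a + \<epsilon>) / 2) * (norm ?p)\<^sup>2"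
        using \<epsilon> m by (intro mult_right_mono) auto
      moreover have "m * (norm ?g)\<^sup>2 \<le> \<epsilon> / 2 * (norm ?g)\<^sup>2"
        using m by (intro mult_right_mono) auto
      ultimately show ?thesis unfolding distrib_left by linarith
    qed
    ultimately show "\<exists>D. ((\<lambda>t. V \<epsilon> (z t)) has_real_derivative D) (at t within {0..}) \<and> D \<le> - m * N (z t)"
      unfolding N_def by blast
  qed
qed

text \<open>Outside the ball, \<open>N\<close> has a positive minimum on the compact set, so a
  trajectory avoiding the ball would lose \<open>V \<epsilon>\<close> at a fixed rate and fall below
  its minimum there.\<close>

lemma trajectory_in_compact_reaches_origin:
  assumes z: "trajectory d \<beta> f z" and K: "compact K" "\<And>t. 0 \<le> t \<Longrightarrow> z t \<in> K"
    and crit: "\<And>q. (q, 0) \<in> K \<Longrightarrow> grad f q = 0 \<Longrightarrow> q = 0" and "0 < r"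
  shows "\<exists>t\<ge>0. norm (z t) < r"
proof (rule ccontr)
  assume no: "\<not> (\<exists>t\<ge>0. norm (z t) < r)"
  obtain m \<epsilon> where m: "0 < m"
    and lyap: "\<forall>z t. trajectory d \<beta> f z \<longrightarrow> 0 \<le> t \<longrightarrow>
      (\<exists>D. ((\<lambda>t. V \<epsilon> (z t)) has_real_derivative D) (at t within {0..}) \<and> D \<le> - m * N (z t))"
    using strict_lyapunov_function by blast
  define K' where "K' = K - ball 0 r"
  have K': "compact K'" unfolding K'_def using K(1) by (rule compact_diff) simp
  have zK': "z t \<in> K'" if "0 \<le> t" for t
    using K(2)[OF that] no that by (auto simp: K'_def)
  have contV: "continuous_on K' (V \<epsilon>)" unfolding V_def
    by (intro continuous_intros continuous_hamiltonian continuous_on_compose2[OF continuous_grad]) auto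
  have contN: "continuous_on K' N" unfolding N_def
    by (intro continuous_intros continuous_on_compose2[OF continuous_grad]) auto
  have ne: "K' \<noteq> {}" using zK'[of 0] by auto
  obtain v where v: "v \<in> K'" "\<And>w. w \<in> K' \<Longrightarrow> V \<epsilon> v \<le> V \<epsilon> w"
    using continuous_attains_inf[OF K' ne contV] by auto
  obtain u where u: "u \<in> K'" "\<And>w. w \<in> K' \<Longrightarrow> N u \<le> N w"
    using continuous_attains_inf[OF K' ne contN] by auto
  have Nu: "N u > 0"
  proof (rule ccontr)
    assume "\<not> N u > 0"
    then have "snd u = 0" "grad f (fst u) = 0"
      by (simp_all add: N_def sum_power2_le_zero_iff not_less)
    then have "u = 0" using crit[of "fst u"] u(1) by (cases u) (auto simp: K'_def zero_prod_def)
    then show False using u(1) \<open>0 < r\<close> by (simp add: K'_def)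
  qed
  obtain D where D: "\<And>t. 0 \<le> t \<Longrightarrow> ((\<lambda>t. V \<epsilon> (z t)) has_real_derivative D t) (at t within {0..})"
    "\<And>t. 0 \<le> t \<Longrightarrow> D t \<le> - m * N (z t)"
    using lyap z by metis
  \<comment> \<open>By time \<open>T\<close> the guaranteed loss exceeds by 1 the largest drop that
    \<open>K'\<close> permits.\<close>
  define T where "T = (V \<epsilon> (z 0) - V \<epsilon> v + 1) / (m * N u)"
  have mN: "m * N u > 0" using m Nu by simp
  have T: "0 \<le> T" using v(2)[OF zK'[of 0]] mN by (simp add: T_def)
  have "V \<epsilon> (z T) + m * N u * T \<le> V \<epsilon> (z 0) + m * N u * 0"
  proof (rule nonincreasing_on_halfline[where b = "T + 1"
        and y = "\<lambda>t. V \<epsilon> (z t) + m * N u * t" and y' = "\<lambda>t. D t + m * N u"])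
    fix t :: real assume t: "0 \<le> t"
    show "((\<lambda>t. V \<epsilon> (z t) + m * N u * t) has_real_derivative D t + m * N u) (at t within {0..})"
      using D(1)[OF t] by (auto intro!: derivative_eq_intros)
    have "m * N u \<le> m * N (z t)" using m u(2)[OF zK'[OF t]] by simp
    then show "D t + m * N u \<le> 0" using D(2)[OF t] by simp
  qed (use T in auto)
  moreover have "m * N u * T = V \<epsilon> (z 0) - V \<epsilon> v + 1"
    using m Nu by (simp add: T_def)
  ultimately have "V \<epsilon> (z T) < V \<epsilon> v" by simp
  then show False using v(2)[OF zK'[OF T]] by simp
qed

end

section \<open>Exponential decay near the origin\<close>

text \<open>\<open>c1\<close> and \<open>c2\<close> bound the effective damping in units of
  \<open>1 / sqrt \<kappa>\<close>. The rate is to depend on \<open>f\<close> and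
  \<open>\<kappa>\<close> only through these two numbers and \<open>sqrt \<kappa>\<close>.\<close>

locale tuned_momentum_flow = momentum_flow +
  fixes c1 c2 :: real
  assumes c1_pos: "0 < c1"
    and c1_le: "c1 \<le> (d + \<beta> / (2 * \<kappa>)) * sqrt \<kappa>"
    and le_c2: "(d + \<beta> / (2 * \<kappa>)) * sqrt \<kappa> \<le> c2"
begin

text \<open>The bound \<open>c1\<close> keeps \<open>\<gamma>\<close> below the effective damping,
  and 1/2 gives \<open>\<gamma>\<^sup>2 * \<kappa> \<le> 1/4\<close>, which controls the mixed term
  of \<open>W\<close>.\<close>

definition "\<gamma>0 = min c1 (1/2)"
definition "M = 1 + 2 * \<gamma>0 * c2"
definition "\<gamma> = \<gamma>0 / sqrt \<kappa>"

text \<open>Twice the Hamiltonian of the linearized system.\<close>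

definition "E w = snd w \<bullet> snd w + fst w \<bullet> (Q *v fst w)"

text \<open>The terms \<open>d * q \<bullet> q\<close> and \<open>\<beta> / 2 * q \<bullet> Q q\<close> cancel the friction contribution to the derivative
  of \<open>q \<bullet> p\<close>, so \<open>W\<close> decays at rate of order \<open>\<gamma>\<close> uniformly over the spectrum of \<open>Q\<close>.\<close>

definition "W w = snd w \<bullet> snd w / 2 + fst w \<bullet> (Q *v fst w) / 2
  + \<gamma> * (fst w \<bullet> snd w + d * (fst w \<bullet> fst w) + \<beta> / 2 * (fst w \<bullet> (Q *v fst w)))"

section \<open>Parameter inequalities and comparison of \<open>E\<close>, \<open>W\<close> and the
  norm\<close>

lemma \<gamma>0: "0 < \<gamma>0" "\<gamma>0 \<le> c1" "\<gamma>0 \<le> 1/2"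
  using c1_pos by (auto simp: \<gamma>0_def)

lemma \<gamma>_pos: "0 < \<gamma>"
  using \<gamma>0 \<kappa>_ge_1 by (simp add: \<gamma>_def)

lemma c2_pos: "0 < c2"
  using c1_pos c1_le le_c2 by linarith

lemma M_ge_1: "1 \<le> M"
  using \<gamma>0 c2_pos by (simp add: M_def)

lemma sqrt_\<kappa>_pos: "0 < sqrt \<kappa>"
  using \<kappa>_ge_1 by auto

lemma \<gamma>_squared: "\<gamma>\<^sup>2 * \<kappa> \<le> 1/4"
proof -
  have "\<gamma>\<^sup>2 * \<kappa> = \<gamma>0\<^sup>2"
    using \<kappa>_ge_1 by (simp add: \<gamma>_def power_divide)
  also have "\<dots> \<le> (1/2)\<^sup>2" using \<gamma>0 by (intro power_mono) auto
  finally show ?thesis by (simp add: power_divide)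
qed

lemma \<gamma>_le_damping: "\<gamma> \<le> d + \<beta> / (2 * \<kappa>)"
proof -
  have "\<gamma> * sqrt \<kappa> = \<gamma>0" using sqrt_\<kappa>_pos by (simp add: \<gamma>_def)
  then have "\<gamma> * sqrt \<kappa> \<le> (d + \<beta> / (2 * \<kappa>)) * sqrt \<kappa>"
    using \<gamma>0(2) c1_le by simp
  then show ?thesis using sqrt_\<kappa>_pos by simp
qed

lemma \<gamma>_damping_le: "\<gamma> * (d * \<kappa> + \<beta> / 2) \<le> \<gamma>0 * c2"
proof -
  have "\<gamma> * (d * \<kappa> + \<beta> / 2) = \<gamma> * \<kappa> * (d + \<beta> / (2 * \<kappa>))"
    using \<kappa>_ge_1 by (simp add: field_simps)
  also have "\<gamma> * \<kappa> = \<gamma>0 * sqrt \<kappa>"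
    using sqrt_\<kappa>_pos by (simp add: \<gamma>_def divide_simps)
  also have "\<gamma>0 * sqrt \<kappa> * (d + \<beta> / (2 * \<kappa>)) \<le> \<gamma>0 * c2"
    using mult_left_mono[OF le_c2, of \<gamma>0] \<gamma>0 by (simp add: mult_ac)
  finally show ?thesis .
qed

lemma norm_le_E: "(norm w)\<^sup>2 \<le> \<kappa> * E w"
proof -
  have "snd w \<bullet> snd w \<le> \<kappa> * (snd w \<bullet> snd w)"
    using mult_right_mono[OF \<kappa>_ge_1, of "snd w \<bullet> snd w"] by simp
  then show ?thesis
    using hessian_lower[of "fst w"]
    by (simp add: E_def norm_prod_def power2_norm_eq_inner distrib_left)
qed

lemma E_le_norm: "E w \<le> (1 + l) * (norm w)\<^sup>2"
proof -
  have "fst w \<bullet> (Q *v fst w) \<le> norm (fst w) * (l * norm (fst w))"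
    by (intro order_trans[OF norm_cauchy_schwarz] mult_left_mono
        lipschitz_derivative_bound[OF grad_has_derivative grad_lipschitz]) auto
  then have "fst w \<bullet> (Q *v fst w) \<le> l * (fst w \<bullet> fst w)"
    by (simp add: power2_eq_square mult_ac flip: power2_norm_eq_inner)
  moreover have "0 \<le> l * (snd w \<bullet> snd w)" "0 \<le> fst w \<bullet> fst w" using l_nonneg by simp_all
  moreover have "(1 + l) * (norm w)\<^sup>2
      = fst w \<bullet> fst w + snd w \<bullet> snd w + l * (fst w \<bullet> fst w) + l * (snd w \<bullet> snd w)"
    by (simp add: norm_prod_def power2_norm_eq_inner algebra_simps)
  ultimately show ?thesis unfolding E_def by linarith
qed

text \<open>Young's inequality leaves \<open>\<gamma>\<^sup>2\<close> times the squared position,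
  which costs a factor \<open>\<kappa>\<close> in terms of \<open>Q\<close>; this forces
  \<open>\<gamma>\<close> to be of order \<open>1 / sqrt \<kappa>\<close>.\<close>

lemma cross_term_bound: "\<bar>\<gamma> * (q \<bullet> p)\<bar> \<le> p \<bullet> p / 4 + q \<bullet> (Q *v q) / 4"
proof -
  have "\<bar>\<gamma> * (q \<bullet> p)\<bar> \<le> \<gamma> * (norm q * norm p)"
    using \<gamma>_pos by (simp add: abs_mult Cauchy_Schwarz_ineq2)
  also have "\<dots> \<le> (norm p)\<^sup>2 / 4 + \<gamma>\<^sup>2 * (norm q)\<^sup>2"
    using zero_le_power2[of "norm p / 2 - \<gamma> * norm q"]
    by (simp add: power2_eq_square field_simps)
  also have "\<gamma>\<^sup>2 * (norm q)\<^sup>2 \<le> \<gamma>\<^sup>2 * (\<kappa> * (q \<bullet> (Q *v q)))"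
    by (intro mult_left_mono hessian_lower) auto
  also have "\<dots> \<le> q \<bullet> (Q *v q) / 4"
    using mult_right_mono[OF \<gamma>_squared hessian_nonneg[of q]] by (simp add: mult_ac)
  finally show ?thesis by (simp add: power2_norm_eq_inner)
qed

lemma E_le_W: "E w \<le> 4 * W w"
proof -
  have "0 \<le> \<gamma> * (d * (fst w \<bullet> fst w) + \<beta> / 2 * (fst w \<bullet> (Q *v fst w)))"
    using \<gamma>_pos d_pos \<beta>_nonneg hessian_nonneg[of "fst w"] by simp
  then show ?thesis
    using cross_term_bound[of "fst w" "snd w"] unfolding E_def W_def distrib_left by linarith
qed

text \<open>Measured by \<open>Q\<close>, the position terms of \<open>W\<close> add up to
  \<open>\<gamma> * (d * \<kappa> + \<beta> / 2)\<close>, which is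
  \<open>\<gamma> * \<kappa>\<close> times the effective damping. The upper bound on the damping
  makes this uniform in \<open>\<kappa>\<close>.\<close>

lemma W_le_E: "W w \<le> M * E w"
proof -
  let ?q = "fst w" and ?p = "snd w"
  let ?h = "?q \<bullet> (Q *v ?q)"
  have h: "0 \<le> ?h" by (rule hessian_nonneg)
  have "d * (?q \<bullet> ?q) \<le> d * (\<kappa> * ?h)"
    using d_pos hessian_lower[of ?q] by (simp add: power2_norm_eq_inner)
  then have "\<gamma> * (d * (?q \<bullet> ?q) + \<beta> / 2 * ?h) \<le> \<gamma> * (d * (\<kappa> * ?h) + \<beta> / 2 * ?h)"
    using \<gamma>_pos by simp
  also have "\<dots> = (\<gamma> * (d * \<kappa> + \<beta> / 2)) * ?h" by (simp add: algebra_simps)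
  also have "\<dots> \<le> \<gamma>0 * c2 * ?h" using h by (intro mult_right_mono \<gamma>_damping_le)
  finally have "W w \<le> ?p \<bullet> ?p / 2 + ?h / 2 + (?p \<bullet> ?p / 4 + ?h / 4) + \<gamma>0 * c2 * ?h"
    using cross_term_bound[of ?q ?p] by (simp add: W_def distrib_left)
  also have "\<dots> \<le> M * E w"
  proof -
    have "0 \<le> \<gamma>0 * c2 * ?h" "0 \<le> \<gamma>0 * c2 * (?p \<bullet> ?p)"
      using \<gamma>0 c2_pos h by auto
    moreover have "M * E w = E w + 2 * (\<gamma>0 * c2 * ?h) + 2 * (\<gamma>0 * c2 * (?p \<bullet> ?p))"
      by (simp add: M_def E_def algebra_simps)
    moreover have "0 \<le> ?p \<bullet> ?p" by simp
    ultimately show ?thesis using h unfolding E_def by linarith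
  qed
  finally show ?thesis .
qed

text \<open>Since \<open>Q\<close> is at least \<open>1 / \<kappa>\<close>, the shift acts as
  additional friction, and the total friction is at least \<open>2 * \<gamma>\<close> times the
  squared momentum. Half of it pays for the momentum term created by differentiating
  \<open>q \<bullet> p\<close>. The vector \<open>\<rho>\<close> is the nonlinear remainder of the
  gradient.\<close>

lemma W_derivative:
  assumes "trajectory d \<beta> f z" "0 \<le> t"
    and \<rho>: "\<rho> = grad f (fst (z t) + \<beta> *\<^sub>R snd (z t)) - Q *v (fst (z t) + \<beta> *\<^sub>R snd (z t))"
  obtains D where "((\<lambda>t. W (z t)) has_real_derivative D) (at t within {0..})"
    and "D \<le> - \<gamma> * E (z t) + (1 + \<gamma>) * norm (z t) * norm \<rho>"
proof -
  define q where "q = fst (z t)"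
  define p where "p = snd (z t)"
  define p' where "p' = - (2 * d) *\<^sub>R p - (Q *v q + \<beta> *\<^sub>R (Q *v p) + \<rho>)"
  have dq: "((\<lambda>t. fst (z t)) has_vector_derivative p) (at t within {0..})"
    using trajectory_position[OF assms(1,2)] by (simp add: p_def)
  have "- (2 * d) *\<^sub>R snd (z t) - grad f (fst (z t) + \<beta> *\<^sub>R snd (z t)) = p'"
    by (simp add: p'_def p_def q_def \<rho> matrix_vector_right_distrib matrix_vector_mult_scaleR)
  then have dp: "((\<lambda>t. snd (z t)) has_vector_derivative p') (at t within {0..})"
    using trajectory_momentum[OF assms(1,2)] by simp
  have dQ: "((\<lambda>t. Q *v fst (z t)) has_vector_derivative Q *v p) (at t within {0..})"
    by (rule bounded_linear.has_vector_derivative[OF matrix_vector_mul_bounded_linear dq])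
  have qQ: "((\<lambda>t. fst (z t) \<bullet> (Q *v fst (z t))) has_real_derivative 2 * (p \<bullet> (Q *v q))) (at t within {0..})"
    by (rule DERIV_cong[OF has_real_derivative_inner[OF dq dQ]])
      (use hessian_symmetric[of p q] in \<open>simp add: q_def\<close>)
  define D where "D = (p \<bullet> p' + p' \<bullet> p) / 2 + 2 * (p \<bullet> (Q *v q)) / 2
    + \<gamma> * (q \<bullet> p' + p \<bullet> p + d * (q \<bullet> p + p \<bullet> q) + \<beta> / 2 * (2 * (p \<bullet> (Q *v q))))"
  have "((\<lambda>t. W (z t)) has_real_derivative D) (at t within {0..})"
    unfolding W_def D_def q_def p_def
    by (intro DERIV_add DERIV_cdivide DERIV_cmult has_real_derivative_inner
        dq[unfolded p_def] dp qQ[unfolded p_def q_def])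
  moreover have "D \<le> - \<gamma> * E (z t) + (1 + \<gamma>) * norm (z t) * norm \<rho>"
  proof -
    have D: "D = - (2 * d * (p \<bullet> p) + \<beta> * (p \<bullet> (Q *v p))) + \<gamma> * (p \<bullet> p) - \<gamma> * (q \<bullet> (Q *v q))
        - (p + \<gamma> *\<^sub>R q) \<bullet> \<rho>"
      using hessian_symmetric[of q p]
      by (simp add: D_def p'_def inner_diff_left inner_diff_right inner_add_left inner_add_right
          inner_commute field_simps)
    have "(2 * \<gamma>) * (p \<bullet> p) \<le> (2 * (d + \<beta> / (2 * \<kappa>))) * (p \<bullet> p)"
      using \<gamma>_le_damping by (intro mult_right_mono) auto
    also have "\<dots> = 2 * d * (p \<bullet> p) + \<beta> * ((p \<bullet> p) / \<kappa>)"
      using \<kappa>_ge_1 by (simp add: field_simps)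
    also have "\<dots> \<le> 2 * d * (p \<bullet> p) + \<beta> * (p \<bullet> (Q *v p))"
      using hessian_lower[of p] \<kappa>_ge_1 \<beta>_nonneg
      by (intro add_left_mono mult_left_mono) (auto simp: power2_norm_eq_inner field_simps)
    finally have fric: "2 * \<gamma> * (p \<bullet> p) \<le> 2 * d * (p \<bullet> p) + \<beta> * (p \<bullet> (Q *v p))" .
    have "norm (p + \<gamma> *\<^sub>R q) \<le> norm p + \<gamma> * norm q"
      using norm_triangle_ineq[of p "\<gamma> *\<^sub>R q"] \<gamma>_pos by simp
    also have "\<dots> \<le> norm (z t) + \<gamma> * norm (z t)"
      unfolding p_def q_def using \<gamma>_pos norm_fst_le[of "fst (z t)" "snd (z t)"] norm_snd_le[of "snd (z t)" "fst (z t)"]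
      by (intro add_mono mult_left_mono) auto
    finally have "norm (p + \<gamma> *\<^sub>R q) \<le> (1 + \<gamma>) * norm (z t)" by (simp add: algebra_simps)
    then have "norm (p + \<gamma> *\<^sub>R q) * norm \<rho> \<le> (1 + \<gamma>) * norm (z t) * norm \<rho>"
      by (rule mult_right_mono) simp
    then have "- ((p + \<gamma> *\<^sub>R q) \<bullet> \<rho>) \<le> (1 + \<gamma>) * norm (z t) * norm \<rho>"
      using Cauchy_Schwarz_ineq2[of "p + \<gamma> *\<^sub>R q" \<rho>] by linarith
    then show ?thesis
      using fric unfolding D E_def p_def[symmetric] q_def[symmetric] distrib_left by linarith
  qed
  ultimately show ?thesis by (rule that)
qed

lemma W_locally_decreasing:
  obtains R where "0 < R"
    and "\<And>z t. trajectory d \<beta> f z \<Longrightarrow> 0 \<le> t \<Longrightarrow> norm (z t) < R \<Longrightarrow>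
      \<exists>D. ((\<lambda>t. W (z t)) has_real_derivative D) (at t within {0..}) \<and> D \<le> - (\<gamma> / (2 * M)) * W (z t)"
proof -
  \<comment> \<open>Accuracy of the linearization at which the remainder, converted to
    \<open>E\<close> at the cost of a factor \<open>\<kappa>\<close>, consumes exactly half of the
    decay \<open>\<gamma> * E\<close>.\<close>
  define \<eta> where "\<eta> = \<gamma> / (2 * (1 + \<beta>) * (1 + \<gamma>) * \<kappa>)"
  have \<eta>: "0 < \<eta>" using \<gamma>_pos \<beta>_nonneg \<kappa>_ge_1 by (simp add: \<eta>_def)
  have \<eta>_eq: "(1 + \<gamma>) * (\<eta> * (1 + \<beta>)) * \<kappa> = \<gamma> / 2"
    using \<gamma>_pos \<beta>_nonneg \<kappa>_ge_1 by (simp add: \<eta>_def divide_simps)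
  obtain \<delta> where \<delta>: "\<delta> > 0"
    "\<And>y. norm y < \<delta> \<Longrightarrow> norm (grad f y - Q *v y) \<le> \<eta> * norm y"
    using grad_has_derivative[of 0] \<eta> unfolding has_derivative_at_alt by (auto simp: grad_0)
  \<comment> \<open>The shifted point has norm at most \<open>1 + \<beta>\<close> times that of the
    state, so it stays within \<open>\<delta>\<close>.\<close>
  define R where "R = \<delta> / (1 + \<beta>)"
  have R: "0 < R" "(1 + \<beta>) * R = \<delta>" using \<delta>(1) \<beta>_nonneg by (auto simp: R_def)
  have "\<exists>D. ((\<lambda>t. W (z t)) has_real_derivative D) (at t within {0..}) \<and> D \<le> - (\<gamma> / (2 * M)) * W (z t)"
    if z: "trajectory d \<beta> f z" "0 \<le> t" and small: "norm (z t) < R" for z and t :: real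
  proof -
    let ?y = "fst (z t) + \<beta> *\<^sub>R snd (z t)"
    have "norm ?y \<le> norm (fst (z t)) + \<beta> * norm (snd (z t))"
      using norm_triangle_ineq[of "fst (z t)" "\<beta> *\<^sub>R snd (z t)"] \<beta>_nonneg by simp
    also have "\<dots> \<le> norm (z t) + \<beta> * norm (z t)"
      using \<beta>_nonneg norm_fst_le[of "fst (z t)" "snd (z t)"] norm_snd_le[of "snd (z t)" "fst (z t)"]
      by (intro add_mono mult_left_mono) auto
    finally have y: "norm ?y \<le> (1 + \<beta>) * norm (z t)" by (simp add: algebra_simps)
    also have "\<dots> < \<delta>" using small \<beta>_nonneg R(2) by (metis mult_strict_left_mono add_pos_nonneg zero_less_one)
    finally have "norm (grad f ?y - Q *v ?y) \<le> \<eta> * norm ?y" by (rule \<delta>(2))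
    also have "\<dots> \<le> \<eta> * ((1 + \<beta>) * norm (z t))" using y \<eta> by simp
    finally have \<rho>: "norm (grad f ?y - Q *v ?y) \<le> \<eta> * (1 + \<beta>) * norm (z t)" by (simp add: mult.assoc)
    obtain D where D: "((\<lambda>t. W (z t)) has_real_derivative D) (at t within {0..})"
      "D \<le> - \<gamma> * E (z t) + (1 + \<gamma>) * norm (z t) * norm (grad f ?y - Q *v ?y)"
      using W_derivative[OF z refl] .
    have "(1 + \<gamma>) * norm (z t) * norm (grad f ?y - Q *v ?y)
        \<le> (1 + \<gamma>) * norm (z t) * (\<eta> * (1 + \<beta>) * norm (z t))"
      using \<rho> \<gamma>_pos by (intro mult_left_mono) auto
    also have "\<dots> = (1 + \<gamma>) * (\<eta> * (1 + \<beta>)) * (norm (z t))\<^sup>2"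
      by (simp add: power2_eq_square)
    also have "\<dots> \<le> (1 + \<gamma>) * (\<eta> * (1 + \<beta>)) * (\<kappa> * E (z t))"
      using \<eta> \<gamma>_pos \<beta>_nonneg norm_le_E[of "z t"] by (intro mult_left_mono) auto
    also have "\<dots> = \<gamma> / 2 * E (z t)" using \<eta>_eq by (simp only: mult.assoc[symmetric])
    finally have "D \<le> - (\<gamma> / 2) * E (z t)" using D(2) by simp
    also have "\<dots> \<le> - (\<gamma> / (2 * M)) * W (z t)"
    proof -
      have "W (z t) / M \<le> E (z t)"
        using W_le_E[of "z t"] M_ge_1 by (simp add: divide_le_eq mult.commute)
      then have "\<gamma> / 2 * (W (z t) / M) \<le> \<gamma> / 2 * E (z t)"
        using \<gamma>_pos by (intro mult_left_mono) auto
      then show ?thesis by (simp add: field_simps)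
    qed
    finally show ?thesis using D(1) by blast
  qed
  with R(1) show ?thesis by (rule that)
qed

text \<open>\<open>W\<close> is quadratic, so its rate \<open>\<gamma> / (2 * M)\<close> is halved
  for the norm. Nonnegativity of \<open>H\<close>, which holds where \<open>f\<close> is close to
  its local minimum, is carried along because the level components are confined to
  \<open>0 \<le> H\<close>.\<close>

lemma local_exponential_decay:
  obtains r C where "0 < r" "0 < C"
    and "\<And>z t. trajectory d \<beta> f z \<Longrightarrow> norm (z 0) < r \<Longrightarrow> 0 \<le> t \<Longrightarrow>
      norm (z t) \<le> C * norm (z 0) * exp (- (\<gamma> / (4 * M)) * t) \<and> 0 \<le> H (z t)"
proof -
  define c where "c = \<gamma> / (4 * M)"
  have c: "0 < c" "\<gamma> / (2 * M) = 2 * c" using \<gamma>_pos M_ge_1 by (auto simp: c_def)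
  obtain R0 where R0: "0 < R0" and W': "\<And>z t. trajectory d \<beta> f z \<Longrightarrow> 0 \<le> t \<Longrightarrow> norm (z t) < R0 \<Longrightarrow>
      \<exists>D. ((\<lambda>t. W (z t)) has_real_derivative D) (at t within {0..}) \<and> D \<le> - (2 * c) * W (z t)"
    using W_locally_decreasing unfolding c(2) by blast
  obtain \<rho> where \<rho>: "0 < \<rho>" "\<And>q. norm q < \<rho> \<Longrightarrow> 0 \<le> f q"
    using f_local_min unfolding eventually_nhds_metric by (auto simp: dist_norm)
  define R where "R = min R0 \<rho>"
  have R: "0 < R" "R \<le> R0" "R \<le> \<rho>" using R0 \<rho>(1) by (auto simp: R_def)
  \<comment> \<open>The product of the constants comparing the squared norm with \<open>E\<close>,
    and \<open>E\<close> with \<open>W\<close>, in both directions.\<close>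
  define C where "C = sqrt (4 * \<kappa> * M * (1 + l))"
  have "1 * 1 \<le> 4 * \<kappa> * M" using \<kappa>_ge_1 M_ge_1 by (intro mult_mono) auto
  then have K: "1 * 1 \<le> 4 * \<kappa> * M * (1 + l)" using l_nonneg by (intro mult_mono) auto
  have C: "1 \<le> C" unfolding C_def by (rule real_sqrt_ge_one) (use K in simp)
  have C2: "C\<^sup>2 = 4 * \<kappa> * M * (1 + l)" unfolding C_def by (rule real_sqrt_pow2) (use K in linarith)
  \<comment> \<open>From this radius the decay estimate keeps the trajectory within
    \<open>R / 2\<close>, strictly inside the ball where it was derived, as the first-exit argument
    requires.\<close>
  define r where "r = R / (2 * C)"
  have r: "0 < r" "r < R" "C * r = R / 2" using R C by (auto simp: r_def field_simps)
  have decay: "norm (z t) \<le> C * norm (z 0) * exp (- c * t)"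
    if z: "trajectory d \<beta> f z" and small: "\<And>s. 0 \<le> s \<Longrightarrow> s < b \<Longrightarrow> norm (z s) < R"
      and t: "0 \<le> t" "t < b" for z b t
  proof -
    obtain D where D: "\<And>s. 0 \<le> s \<Longrightarrow> s < b \<Longrightarrow>
        ((\<lambda>t. W (z t)) has_real_derivative D s) (at s within {0..}) \<and> D s \<le> - (2 * c) * W (z s)"
      using W'[OF z] small R(2) by (metis less_le_trans)
    have "W (z t) \<le> W (z 0) * exp (- (2 * c) * t)"
      by (rule exponential_decay_on_halfline[of b "\<lambda>t. W (z t)" D]) (use D t in auto)
    then have *: "\<kappa> * (4 * W (z t)) \<le> \<kappa> * (4 * (W (z 0) * exp (- (2 * c) * t)))"
      using \<kappa>_ge_1 by (intro mult_left_mono) auto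
    have "(norm (z t))\<^sup>2 \<le> \<kappa> * E (z t)" by (rule norm_le_E)
    also have "\<dots> \<le> \<kappa> * (4 * W (z t))" using E_le_W[of "z t"] \<kappa>_ge_1 by (intro mult_left_mono) auto
    also note *
    also have "W (z 0) \<le> M * ((1 + l) * (norm (z 0))\<^sup>2)"
      using W_le_E[of "z 0"] mult_left_mono[OF E_le_norm[of "z 0"], of M] M_ge_1 by linarith
    finally have "(norm (z t))\<^sup>2 \<le> \<kappa> * (4 * (M * ((1 + l) * (norm (z 0))\<^sup>2) * exp (- (2 * c) * t)))"
      using \<kappa>_ge_1 by simp
    also have "\<dots> = (C * norm (z 0) * exp (- c * t))\<^sup>2"
      by (simp add: power_mult_distrib C2 power2_eq_square[of "exp _"] flip: exp_add)
    finally show ?thesis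
      by (rule power2_le_imp_le) (use C in auto)
  qed
  have "norm (z t) \<le> C * norm (z 0) * exp (- c * t) \<and> 0 \<le> H (z t)"
    if z: "trajectory d \<beta> f z" and z0: "norm (z 0) < r" and t: "0 \<le> t" for z and t :: real
  proof -
    have small: "norm (z s) < R" if "0 \<le> s" for s
    proof (rule bounded_by_first_exit[of "\<lambda>s. norm (z s)" R "R / 2"])
      show "continuous_on {0..} (\<lambda>s. norm (z s))"
        by (intro continuous_intros continuous_trajectory z)
      fix b u :: real assume *: "\<And>s. 0 \<le> s \<Longrightarrow> s < b \<Longrightarrow> norm (z s) < R" and u: "0 \<le> u" "u < b"
      have "norm (z u) \<le> C * norm (z 0) * exp (- c * u)"
        by (rule decay[OF z _ u]) (rule *)
      also have "\<dots> \<le> C * norm (z 0) * 1"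
        using C c u by (intro mult_left_mono) auto
      also have "\<dots> \<le> C * r" using z0 C by simp
      finally show "norm (z u) \<le> R / 2" using r by simp
    qed (use z0 r R that in auto)
    have "norm (fst (z t)) < \<rho>"
      using small[OF t] norm_fst_le[of "fst (z t)" "snd (z t)"] R(3) by simp
    then have "0 \<le> H (z t)" using \<rho>(2) by (simp add: hamiltonian_eq)
    with decay[OF z small t, of "t + 1"] show ?thesis by simp
  qed
  with r(1) C show ?thesis unfolding c_def by (intro that[of r C]) auto
qed

end

section \<open>The basin of attraction\<close>

context tuned_momentum_flow
begin

text \<open>A clopen argument in the connected set \<open>A_set f\<close>. Closedness is the hard
  half: an orbit starting at a limit point must be trapped in a compact level component before the
  Lyapunov argument applies.\<close>

lemma basin_contains_A_set:
  assumes compact: "compact_level_components f" and "0 < r"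
    and decay: "\<And>z t. trajectory d \<beta> f z \<Longrightarrow> norm (z 0) < r \<Longrightarrow> 0 \<le> t \<Longrightarrow>
      norm (z t) \<le> C * norm (z 0) * exp (- c * t) \<and> 0 \<le> H (z t)"
    and "0 < c"
  shows "A_set f \<subseteq> {z. \<exists>T\<ge>0. norm (\<phi> T z) < r}"
proof -
  define G where "G = {z. \<exists>T\<ge>0. norm (\<phi> T z) < r}"
  have decay_flow: "norm (\<phi> (T + t) z) \<le> C * norm (\<phi> T z) * exp (- c * t) \<and> 0 \<le> H (\<phi> (T + t) z)"
    if "0 \<le> T" "norm (\<phi> T z) < r" "0 \<le> t" for T z t
    using decay[OF trajectory_flow[of "\<phi> T z"]] that by (simp add: flow_add)
  have H_mono: "H (\<phi> t z) \<le> H (\<phi> s z)" if "0 \<le> s" "s \<le> t" for s t z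
    using hamiltonian_nonincreasing[OF trajectory_flow that] .
  have H_nonneg: "0 \<le> H (\<phi> t z)" if z: "z \<in> G" and t: "0 \<le> t" for z t
  proof -
    obtain T where T: "0 \<le> T" "norm (\<phi> T z) < r" using z by (auto simp: G_def)
    show ?thesis
    proof (cases "t \<le> T")
      case True
      then show ?thesis using H_mono[OF t True, of z] decay_flow[OF T order_refl] by simp
    next
      case False
      then show ?thesis using decay_flow[OF T, of "t - T"] by simp
    qed
  qed
  have orbit_connected: "connected ((\<lambda>t. \<phi> t z) ` {0..})" for z
    by (intro connected_continuous_image continuous_trajectory trajectory_flow) auto
  have to_0: "0 \<in> closure ((\<lambda>t. \<phi> t z) ` {0..})" if z: "z \<in> G" for z
    unfolding closure_approachable
  proof (intro allI impI)
    fix e :: real assume e: "e > 0"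
    obtain T where T: "0 \<le> T" "norm (\<phi> T z) < r" using z by (auto simp: G_def)
    have "((\<lambda>t. C * norm (\<phi> T z) * exp (- c * t)) \<longlongrightarrow> 0) at_top"
      using \<open>0 < c\<close>
      by (intro tendsto_mult_right_zero filterlim_compose[OF exp_at_bot]
          filterlim_tendsto_neg_mult_at_bot[OF tendsto_const _ filterlim_ident]) auto
    then have "\<forall>\<^sub>F t in at_top. C * norm (\<phi> T z) * exp (- c * t) < e"
      using e by (rule order_tendstoD)
    then obtain t where t: "0 \<le> t" "C * norm (\<phi> T z) * exp (- c * t) < e"
      using eventually_happens'[OF _ eventually_conj[OF eventually_ge_at_top[of 0]]] by auto
    then have "norm (\<phi> (T + t) z) < e" using decay_flow[OF T t(1)] by simp
    then show "\<exists>y\<in>(\<lambda>t. \<phi> t z) ` {0..}. dist y 0 < e"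
      using T(1) t(1) by (intro bexI[of _ "\<phi> (T + t) z"]) auto
  qed
  have "H 0 = 0" by (simp add: hamiltonian_eq f_0)
  \<comment> \<open>The orbit together with its limit 0 is connected, and along it \<open>H\<close>
    stays between 0 and its initial value; so it links \<open>z\<close> to the origin within the
    level set.\<close>
  have joined: "z \<in> connected_component_set {z. H z \<in> {0..c'}} 0"
    if z: "z \<in> G" and "H z \<le> c'" for z c'
  proof -
    let ?S = "(\<lambda>t. \<phi> t z) ` {0..}"
    have "connected (insert 0 ?S)"
      by (rule connected_intermediate_closure[OF orbit_connected[of z]])
        (use to_0[OF z] closure_subset[of ?S] in auto)
    moreover have "insert 0 ?S \<subseteq> {z. H z \<in> {0..c'}}"
    proof (intro insert_subsetI image_subsetI)
      have "0 \<le> H z" using H_nonneg[OF z order_refl] by simp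
      then show "0 \<in> {z. H z \<in> {0..c'}}" using \<open>H z \<le> c'\<close> \<open>H 0 = 0\<close> by simp
      show "\<phi> t z \<in> {z. H z \<in> {0..c'}}" if "t \<in> {0..}" for t
        using H_mono[OF order_refl, of t z] H_nonneg[OF z, of t] that \<open>H z \<le> c'\<close> by simp
    qed
    ultimately have "insert 0 ?S \<subseteq> connected_component_set {z. H z \<in> {0..c'}} 0"
      by (intro connected_component_maximal) auto
    moreover have "\<phi> 0 z \<in> ?S" by (rule imageI) simp
    ultimately show ?thesis by auto
  qed
  have openG: "open G"
  proof -
    have "G = (\<Union>T\<in>{0..}. {z. norm (\<phi> T z) < r})" by (auto simp: G_def)
    also have "open \<dots>"
      by (intro open_UN ballI open_Collect_less continuous_intros continuous_flow) auto
    finally show ?thesis .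
  qed
  have closedG: "z \<in> G" if zA: "z \<in> A_set f" and zcl: "z \<in> closure (G \<inter> A_set f)" for z
  proof -
    obtain x where x: "\<And>n. x n \<in> G" "x \<longlonglongrightarrow> z"
      using zcl unfolding closure_sequential by auto
    \<comment> \<open>Convergence of the orbit of \<open>z\<close> to the origin is not yet known,
      so nonnegativity is inherited from the approximating orbits at each fixed time.\<close>
    have Hnn: "0 \<le> H (\<phi> t z)" if "0 \<le> t" for t
    proof (rule tendsto_lowerbound)
      have "continuous_on UNIV (\<lambda>z. H (\<phi> t z))"
        by (rule continuous_on_compose2[OF continuous_hamiltonian continuous_flow[OF that]]) auto
      then show "(\<lambda>n. H (\<phi> t (x n))) \<longlonglongrightarrow> H (\<phi> t z)"
        by (rule continuous_on_tendsto_compose[OF _ x(2)]) auto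
      show "\<forall>\<^sub>F n in sequentially. 0 \<le> H (\<phi> t (x n))"
        using H_nonneg[OF x(1) that] by simp
    qed simp
    have "ereal (H z) < f_hat f"
      using connected_component_subset[of "{z. 0 \<le> H z \<and> ereal (H z) < f_hat f}" 0] zA
      unfolding A_set_def by auto
    \<comment> \<open>The strict gap above \<open>H z\<close> puts almost all \<open>x n\<close>
      into one and the same compact component, which then contains their limit.\<close>
    then obtain c' where c': "H z < c'" "ereal c' < f_hat f"
      using ereal_dense2 by (metis ereal_less_eq(3) less_ereal.simps(1))
    have "0 < c'" using Hnn[of 0] c'(1) by simp
    define K where "K = connected_component_set {z. H z \<in> {0..c'}} 0"
    have K: "compact K"
      using compact \<open>0 < c'\<close> c'(2) unfolding compact_level_components_def K_def Let_def by blast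
    have "(\<lambda>n. H (x n)) \<longlonglongrightarrow> H z"
      by (rule continuous_on_tendsto_compose[OF continuous_hamiltonian[of UNIV] x(2)]) auto
    then have "\<forall>\<^sub>F n in sequentially. H (x n) < c'"
      using c'(1) by (rule order_tendstoD)
    then have "\<forall>\<^sub>F n in sequentially. x n \<in> K"
      by eventually_elim (use joined[OF x(1)] in \<open>auto simp: K_def\<close>)
    then have "z \<in> K"
      by (rule Lim_in_closed_set[OF compact_imp_closed[OF K] _ _ x(2)]) simp
    have "H (\<phi> t z) \<le> c'" if "0 \<le> t" for t
      using H_mono[OF order_refl that, of z] c'(1) by simp
    then have "(\<lambda>t. \<phi> t z) ` {0..} \<subseteq> connected_component_set {z. H z \<in> {0..c'}} z"
    proof (intro connected_component_maximal orbit_connected image_subsetI)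
      show "z \<in> (\<lambda>t. \<phi> t z) ` {0..}" using imageI[of 0 "{0..}" "\<lambda>t. \<phi> t z"] by simp
      show "\<phi> t z \<in> {z. H z \<in> {0..c'}}" if "t \<in> {0..}" for t
        using \<open>\<And>t. 0 \<le> t \<Longrightarrow> H (\<phi> t z) \<le> c'\<close> Hnn that by simp
    qed
    also have "\<dots> = K"
      using \<open>z \<in> K\<close> unfolding K_def by (metis connected_component_eq)
    finally have orbit: "\<And>t. 0 \<le> t \<Longrightarrow> \<phi> t z \<in> K" by auto
    \<comment> \<open>Another critical point would have energy at least \<open>f_hat f\<close>, but
      energies in \<open>K\<close> are at most \<open>c'\<close>.\<close>
    have "q = 0" if q: "(q, 0) \<in> K" "grad f q = 0" for q
    proof (rule ccontr)
      assume "q \<noteq> 0"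
      then have "f_hat f \<le> ereal (f q)"
        unfolding f_hat_def using q(2) by (intro INF_lower) (simp add: critical_points_def)
      moreover have "(q, 0) \<in> {z. H z \<in> {0..c'}}"
        using q(1) connected_component_subset unfolding K_def by blast
      ultimately show False using c'(2) by (auto simp: hamiltonian_eq)
        (meson ereal_less_eq(3) leD le_less_trans less_le_trans)
    qed
    then show ?thesis
      using trajectory_in_compact_reaches_origin[OF trajectory_flow K orbit _ \<open>0 < r\<close>]
      by (auto simp: G_def)
  qed
  have "A_set f \<inter> G = {} \<or> A_set f \<inter> G = A_set f"
  proof -
    have "openin (top_of_set (A_set f)) (A_set f \<inter> G)"
      using openG by (rule openin_open_Int)
    moreover have "closedin (top_of_set (A_set f)) (A_set f \<inter> G)"
      unfolding closedin_closed
      by (rule exI[of _ "closure (G \<inter> A_set f)"]) (use closedG closure_subset[of "G \<inter> A_set f"] in blast)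
    moreover have "connected (A_set f)" unfolding A_set_def by simp
    ultimately show ?thesis unfolding connected_clopen by blast
  qed
  moreover have "0 \<in> G" using \<open>0 < r\<close> by (auto simp: G_def intro: exI[of _ 0])
  \<comment> \<open>\<open>connected_component_set\<close> is empty when its base point lies outside
    the set; the inclusion is then trivial.\<close>
  moreover have "0 \<in> A_set f" if "A_set f \<noteq> {}"
    using that connected_component_in connected_component_refl unfolding A_set_def by fastforce
  ultimately show ?thesis unfolding G_def by blast
qed

text \<open>Finitely many of the open sets of states that lie in the ball at a given time cover
  \<open>A\<close>, which bounds the entry time uniformly. Gronwall's bound covers the time up to
  entry and local decay the rest.\<close>

lemma exponential_decay_on_compact:
  assumes "compact_level_components f" "compact A" "A \<subseteq> A_set f"
  shows "\<exists>Ca>0. \<forall>t\<ge>0. \<forall>z\<in>A. norm (\<phi> t z) \<le> Ca * norm z * exp (- (\<gamma> / (4 * M)) * t)"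
proof -
  define c where "c = \<gamma> / (4 * M)"
  have c: "0 < c" using \<gamma>_pos M_ge_1 by (simp add: c_def)
  obtain r C where rC: "0 < r" "0 < C"
    and decay: "\<And>z t. trajectory d \<beta> f z \<Longrightarrow> norm (z 0) < r \<Longrightarrow> 0 \<le> t \<Longrightarrow>
      norm (z t) \<le> C * norm (z 0) * exp (- c * t) \<and> 0 \<le> H (z t)"
    using local_exponential_decay unfolding c_def by blast
  have "A_set f \<subseteq> {z. \<exists>T\<ge>0. norm (\<phi> T z) < r}"
    by (rule basin_contains_A_set[OF assms(1) rC(1) decay c])
  then have cover: "A \<subseteq> (\<Union>T\<in>{0..}. {z. norm (\<phi> T z) < r})" using assms(3) by blast
  have "open {z. norm (\<phi> T z) < r}" if "T \<in> {0..}" for T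
    using that by (intro open_Collect_less continuous_intros continuous_flow) auto
  with compactE_image[OF assms(2) _ cover] obtain \<T> where
    \<T>: "\<T> \<subseteq> {0..}" "finite \<T>" "A \<subseteq> (\<Union>T\<in>\<T>. {z. norm (\<phi> T z) < r})" by metis
  define Tm where "Tm = Max (insert 0 \<T>)"
  have Tm: "0 \<le> Tm" "\<And>T. T \<in> \<T> \<Longrightarrow> T \<le> Tm" using \<T>(2) by (auto simp: Tm_def)
  \<comment> \<open>\<open>exp (L * Tm)\<close> bounds growth up to entry,
    \<open>exp (c * Tm)\<close> compensates for the decay missing during that time, and
    \<open>1 + C\<close> dominates both 1 and \<open>C\<close>.\<close>
  define Ca where "Ca = (1 + C) * exp (L * Tm) * exp (c * Tm)"
  have "norm (\<phi> t z) \<le> Ca * norm z * exp (- c * t)" if t: "0 \<le> t" and z: "z \<in> A" for t z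
  proof -
    obtain T where T: "T \<in> \<T>" "norm (\<phi> T z) < r" using \<T>(3) z by auto
    have T0: "0 \<le> T" "T \<le> Tm" using T(1) \<T>(1) Tm(2) by auto
    have grow: "norm (\<phi> s z) \<le> exp (L * Tm) * norm z" if "0 \<le> s" "s \<le> Tm" for s
    proof -
      have "norm (\<phi> s z) \<le> exp (L * s) * norm z" by (rule norm_flow_le[OF that(1)])
      also have "\<dots> \<le> exp (L * Tm) * norm z"
        using that L_nonneg by (intro mult_right_mono) (auto intro: mult_left_mono)
      finally show ?thesis .
    qed
    show ?thesis
    proof (cases "t \<le> T")
      case True
      have "norm (\<phi> t z) \<le> exp (L * Tm) * norm z * 1" using grow[OF t] True T0 by simp
      also have "\<dots> \<le> exp (L * Tm) * norm z * ((1 + C) * exp (c * (Tm - t)))"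
      proof (intro mult_left_mono)
        have "0 \<le> c * (Tm - t)" using c True T0 by simp
        then show "1 \<le> (1 + C) * exp (c * (Tm - t))"
          using mult_mono[of 1 "1 + C" 1 "exp (c * (Tm - t))"] rC by simp
      qed auto
      also have "\<dots> = Ca * norm z * exp (- c * t)"
        by (simp add: Ca_def right_diff_distrib exp_diff exp_minus divide_inverse)
      finally show ?thesis .
    next
      case False
      have "norm (\<phi> t z) \<le> C * norm (\<phi> T z) * exp (- c * (t - T))"
        using decay[OF trajectory_flow[of "\<phi> T z"], of "t - T"] T T0 False by (simp add: flow_add)
      also have "\<dots> \<le> (1 + C) * (exp (L * Tm) * norm z) * (exp (- c * t) * exp (c * Tm))"
      proof (intro mult_mono)
        show "norm (\<phi> T z) \<le> exp (L * Tm) * norm z" by (rule grow[OF T0])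
        have "c * T \<le> c * Tm" using c T0 by simp
        then show "exp (- c * (t - T)) \<le> exp (- c * t) * exp (c * Tm)"
          by (simp add: algebra_simps flip: exp_add)
      qed (use rC in auto)
      also have "\<dots> = Ca * norm z * exp (- c * t)" by (simp add: Ca_def)
      finally show ?thesis .
    qed
  qed
  moreover have "0 < Ca" using rC by (simp add: Ca_def)
  ultimately show ?thesis unfolding c_def by blast
qed

end

section \<open>Acceleration\<close>

text \<open>The local minimum makes the Hessian positive semidefinite and nondegeneracy excludes the
  eigenvalue 0. Positivity of the smallest eigenvalue \<open>m\<close> has to come first, since a
  bound on the quotient \<open>1 / m\<close> says nothing about the sign of
  \<open>m\<close>.\<close>

lemma function_class_hessian_lower:
  fixes f :: "real^'n \<Rightarrow> real"
  assumes f: "f \<in> function_class A \<kappa> Cf Cf'" and "1 \<le> \<kappa>"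
  shows "(norm x)\<^sup>2 \<le> \<kappa> * (x \<bullet> (hessian f 0 *v x))"
proof -
  let ?Q = "hessian f 0"
  have f_diff: "\<And>x. f differentiable (at x)" and grad_diff: "grad f differentiable (at 0)"
    and inv: "\<And>x. x \<in> critical_points f \<Longrightarrow> invertible (hessian f x)"
    and cond: "max_curvature f = 1" "condition_number f \<le> \<kappa>"
    and min: "isolated_local_min f 0"
    using f by (auto simp: function_class_def)
  have G: "\<And>x. GDERIV f x :> grad f x" by (rule GDERIV_grad[OF f_diff])
  have Q: "(grad f has_derivative (\<lambda>h. ?Q *v h)) (at 0)"
    using grad_diff unfolding hessian_def jacobian_works .
  have loc: "\<forall>\<^sub>F z in nhds 0. f 0 \<le> f z"
    using min by (simp add: isolated_local_min_def isolated_in_def)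
  have "(\<lambda>h. h \<bullet> grad f 0) = (\<lambda>h. 0)"
    using G[of 0] loc unfolding gderiv_def
    by (intro has_derivative_local_min[of f _ 0]) (auto simp: eventually_nhds_conv_at)
  then have g0: "grad f 0 = 0" by (metis inner_eq_zero_iff)
  have sym: "u \<bullet> (?Q *v v) = v \<bullet> (?Q *v u)" for u v
    by (rule second_derivative_symmetric[OF G Q])
  have psd: "0 \<le> u \<bullet> (?Q *v u)" for u
    by (rule second_derivative_nonneg_at_local_min[OF G Q g0 loc])
  have fin: "finite (eigenvalues ?Q)" by (rule symmetric_matrix_finite_eigenvalues[OF sym])
  obtain \<mu> where \<mu>: "\<mu> \<in> eigenvalues ?Q" "\<And>x. \<mu> * (norm x)\<^sup>2 \<le> x \<bullet> (?Q *v x)"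
    using symmetric_matrix_min_eigenvalue[OF sym] by blast
  define m where "m = min_curvature f"
  have "m \<in> eigenvalues ?Q" "m \<le> \<mu>"
    unfolding m_def min_curvature_def using Min_in[OF fin] Min_le[OF fin] \<mu>(1) by auto
  then obtain v where v: "v \<noteq> 0" "?Q *v v = m *\<^sub>R v" by (auto simp: eigenvalues_def)
  have "m \<noteq> 0"
  proof
    assume "m = 0"
    then have "?Q *v v = ?Q *v 0" using v(2) by simp
    moreover have "invertible ?Q" using inv g0 by (simp add: critical_points_def)
    ultimately show False using v(1) by (metis inj_matrix_vector_mult injD)
  qed
  moreover have "0 \<le> m * (v \<bullet> v)" using psd[of v] v(2) by simp
  then have "0 \<le> m" using v(1) by (smt (verit) inner_gt_zero_iff mult_neg_pos)
  ultimately have "0 < m" by simp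
  have "1 / m \<le> \<kappa>" using cond by (simp add: condition_number_def m_def)
  then have "1 \<le> \<kappa> * m" using \<open>0 < m\<close> by (simp add: pos_divide_le_eq)
  then have "1 * (norm x)\<^sup>2 \<le> (\<kappa> * m) * (norm x)\<^sup>2" by (rule mult_right_mono) simp
  also have "\<dots> \<le> \<kappa> * (\<mu> * (norm x)\<^sup>2)"
    using \<open>m \<le> \<mu>\<close> \<open>1 \<le> \<kappa>\<close> by (simp add: mult_right_mono)
  also have "\<dots> \<le> \<kappa> * (x \<bullet> (?Q *v x))"
    using \<mu>(2)[of x] \<open>1 \<le> \<kappa>\<close> by (intro mult_left_mono) auto
  finally show ?thesis by simp
qed

text \<open>The common core of both cases. The constant for \<open>ca\<close> is
  \<open>\<gamma>0 / (4 * M)\<close> written out in \<open>c1\<close> and \<open>c2\<close>, hence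
  the same for all \<open>f\<close> and all \<kappa> beyond \<open>\<kappa>0\<close>.\<close>

lemma accelerated_if_damping_comparable:
  fixes A :: "((real^'n) \<times> (real^'n)) set"
  assumes "compact A" "1 \<le> \<kappa>0" "0 < c1" "0 < c2"
    and bounds: "\<And>\<kappa>. \<kappa>0 \<le> \<kappa> \<Longrightarrow> c1 \<le> (d \<kappa> + \<beta> \<kappa> / (2 * \<kappa>)) * sqrt \<kappa>"
      "\<And>\<kappa>. \<kappa>0 \<le> \<kappa> \<Longrightarrow> (d \<kappa> + \<beta> \<kappa> / (2 * \<kappa>)) * sqrt \<kappa> \<le> c2"
    and params: "\<And>\<kappa>. \<kappa>0 \<le> \<kappa> \<Longrightarrow> 0 < d \<kappa> \<and> 0 \<le> \<beta> \<kappa> \<and> Cf * \<beta> \<kappa> < 2 * d \<kappa>"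
  shows "accelerated A Cf Cf' d \<beta>"
  unfolding accelerated_def
proof (rule exI[of _ \<kappa>0], rule conjI[OF \<open>1 \<le> \<kappa>0\<close>],
    rule exI[of _ "min c1 (1/2) / (4 * (1 + 2 * min c1 (1/2) * c2))"], intro conjI allI impI ballI)
  show "0 < min c1 (1/2) / (4 * (1 + 2 * min c1 (1/2) * c2))"
    using assms(3,4) by (intro divide_pos_pos mult_pos_pos add_pos_nonneg) auto
  fix \<kappa> and f :: "real^'n \<Rightarrow> real"
  assume \<kappa>: "\<kappa>0 \<le> \<kappa>" and f: "f \<in> function_class A \<kappa> Cf Cf'"
  have \<kappa>1: "1 \<le> \<kappa>" using \<kappa> \<open>1 \<le> \<kappa>0\<close> by simp
  obtain l where l: "l-lipschitz_on UNIV (grad f)" using f by (auto simp: function_class_def)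
  interpret tuned_momentum_flow f "d \<kappa>" "\<beta> \<kappa>" Cf \<kappa> l c1 c2
  proof
    show "\<forall>\<^sub>F x in nhds 0. 0 \<le> f x"
      using f by (auto simp: function_class_def isolated_local_min_def isolated_in_def)
    show "(norm x)\<^sup>2 \<le> \<kappa> * (x \<bullet> (hessian f 0 *v x))" for x
      by (rule function_class_hessian_lower[OF f \<kappa>1])
  qed (use f l \<kappa>1 bounds[OF \<kappa>] params[OF \<kappa>] \<open>0 < c1\<close> in \<open>simp_all add: function_class_def\<close>)
  have "- (\<gamma> / (4 * M)) * t = - (min c1 (1/2) / (4 * (1 + 2 * min c1 (1/2) * c2))) * t / sqrt \<kappa>" for t
    by (simp add: \<gamma>_def M_def \<gamma>0_def)
  moreover have "compact_level_components f" "A \<subseteq> A_set f"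
    using f by (auto simp: function_class_def)
  ultimately show "\<exists>Ca>0. \<forall>t\<ge>0. \<forall>z0\<in>A. norm (flow (d \<kappa>) (\<beta> \<kappa>) f t z0)
      \<le> Ca * norm z0 * exp (- (min c1 (1/2) / (4 * (1 + 2 * min c1 (1/2) * c2))) * t / sqrt \<kappa>)"
    using exponential_decay_on_compact[OF _ \<open>compact A\<close>] by simp
qed

text \<open>The lower bound comes from the limit of the inverse ratio. Using \<bar>l\<bar> + 1
  instead of the limit makes both constants positive and leaves room for the inequality to hold
  eventually.\<close>

lemma same_order_bounds:
  assumes "u1 \<asymp> u2"
  obtains c1 c2 where "0 < c1" "0 < c2"
    "\<forall>\<^sub>F \<kappa> in at_top. c1 \<le> u1 \<kappa> / u2 \<kappa> \<and> u1 \<kappa> / u2 \<kappa> \<le> c2"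
proof -
  from assms obtain l l' where pos: "\<forall>\<^sub>F \<kappa> in at_top. u1 \<kappa> > 0" "\<forall>\<^sub>F \<kappa> in at_top. u2 \<kappa> > 0"
    and lim: "((\<lambda>\<kappa>. u1 \<kappa> / u2 \<kappa>) \<longlongrightarrow> l) at_top" "((\<lambda>\<kappa>. u2 \<kappa> / u1 \<kappa>) \<longlongrightarrow> l') at_top"
    unfolding same_order_def by auto
  have "\<forall>\<^sub>F \<kappa> in at_top. u1 \<kappa> / u2 \<kappa> < \<bar>l\<bar> + 1" by (rule order_tendstoD[OF lim(1)]) simp
  moreover have "\<forall>\<^sub>F \<kappa> in at_top. u2 \<kappa> / u1 \<kappa> < \<bar>l'\<bar> + 1" by (rule order_tendstoD[OF lim(2)]) simp
  ultimately have "\<forall>\<^sub>F \<kappa> in at_top. 1 / (\<bar>l'\<bar> + 1) \<le> u1 \<kappa> / u2 \<kappa> \<and> u1 \<kappa> / u2 \<kappa> \<le> \<bar>l\<bar> + 1"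
    using pos by eventually_elim (auto simp: field_simps add_pos_nonneg)
  then show ?thesis by (intro that[of "1 / (\<bar>l'\<bar> + 1)" "\<bar>l\<bar> + 1"]) auto
qed

theorem proposition8:
  fixes A :: "((real^'n) \<times> (real^'n)) set" and Cf Cf' :: real
  assumes "compact A" and "0 \<in> A" and "0 \<le> Cf" and "0 < Cf'"
  shows "(0 < Cf \<longrightarrow>
      (\<forall>d \<beta>. d \<asymp> (\<lambda>\<kappa>. 1 / sqrt \<kappa>) \<and>
            (\<forall>\<kappa>\<ge>1. 0 < d \<kappa> \<and> 0 \<le> \<beta> \<kappa> \<and> \<beta> \<kappa> < 2 * d \<kappa> / Cf) \<longrightarrow>
            accelerated A Cf Cf' d \<beta>)) \<and>
    (Cf = 0 \<longrightarrow>
      (\<forall>d \<beta>. (\<lambda>\<kappa>. d \<kappa> + \<beta> \<kappa> / (2 * \<kappa>)) \<asymp> (\<lambda>\<kappa>. 1 / sqrt \<kappa>) \<and>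
            (\<forall>\<kappa>\<ge>1. 0 < d \<kappa> \<and> 0 \<le> \<beta> \<kappa>) \<longrightarrow>
            accelerated A Cf Cf' d \<beta>))"
proof (intro conjI impI allI; elim conjE)
  fix d \<beta> :: "real \<Rightarrow> real"
  assume Cf: "0 < Cf" and order: "d \<asymp> (\<lambda>\<kappa>. 1 / sqrt \<kappa>)"
    and params: "\<forall>\<kappa>\<ge>1. 0 < d \<kappa> \<and> 0 \<le> \<beta> \<kappa> \<and> \<beta> \<kappa> < 2 * d \<kappa> / Cf"
  obtain c1 c2 where c: "0 < c1" "0 < c2"
    "\<forall>\<^sub>F \<kappa> in at_top. c1 \<le> d \<kappa> / (1 / sqrt \<kappa>) \<and> d \<kappa> / (1 / sqrt \<kappa>) \<le> c2"
    using same_order_bounds[OF order] .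
  then obtain \<kappa>1 where \<kappa>1: "\<And>\<kappa>. \<kappa>1 \<le> \<kappa> \<Longrightarrow> c1 \<le> d \<kappa> * sqrt \<kappa> \<and> d \<kappa> * sqrt \<kappa> \<le> c2"
    by (auto simp: eventually_at_top_linorder)
  show "accelerated A Cf Cf' d \<beta>"
  \<comment> \<open>The threshold is at least 1 because the parameter constraints hold from there
    on. The factor \<open>1 + 1 / Cf\<close> accounts for the shift: for
    \<open>\<kappa> \<ge> 1\<close>, \<open>\<beta> \<kappa> / (2 * \<kappa>)\<close> is at most
    \<open>d \<kappa> / Cf\<close>.\<close>
  proof (rule accelerated_if_damping_comparable[OF \<open>compact A\<close>,
        where ?\<kappa>0.0 = "max 1 \<kappa>1" and ?c1.0 = c1 and ?c2.0 = "c2 * (1 + 1 / Cf)"])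
    show "0 < c2 * (1 + 1 / Cf)" using c Cf by (simp add: add_pos_nonneg)
    fix \<kappa> assume "max 1 \<kappa>1 \<le> \<kappa>"
    then have \<kappa>: "1 \<le> \<kappa>" "\<kappa>1 \<le> \<kappa>" by auto
    have b: "0 < d \<kappa>" "0 \<le> \<beta> \<kappa>" "\<beta> \<kappa> < 2 * d \<kappa> / Cf" using params \<kappa>(1) by auto
    then show "0 < d \<kappa> \<and> 0 \<le> \<beta> \<kappa> \<and> Cf * \<beta> \<kappa> < 2 * d \<kappa>"
      using Cf by (simp add: pos_less_divide_eq mult.commute)
    have "0 \<le> \<beta> \<kappa> / (2 * \<kappa>)" using b \<kappa> by simp
    then have "d \<kappa> * sqrt \<kappa> \<le> (d \<kappa> + \<beta> \<kappa> / (2 * \<kappa>)) * sqrt \<kappa>"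
      using \<kappa> by (intro mult_right_mono) auto
    then show "c1 \<le> (d \<kappa> + \<beta> \<kappa> / (2 * \<kappa>)) * sqrt \<kappa>" using \<kappa>1[OF \<kappa>(2)] by linarith
    have "\<beta> \<kappa> / (2 * \<kappa>) \<le> \<beta> \<kappa> / 2"
      using b \<kappa> by (intro divide_left_mono) auto
    also have "\<dots> \<le> d \<kappa> / Cf" using b(3) Cf by (simp add: field_simps)
    finally have "(d \<kappa> + \<beta> \<kappa> / (2 * \<kappa>)) * sqrt \<kappa> \<le> (d \<kappa> + d \<kappa> / Cf) * sqrt \<kappa>"
      using \<kappa> by (intro mult_right_mono) auto
    also have "\<dots> = d \<kappa> * sqrt \<kappa> * (1 + 1 / Cf)" by (simp add: algebra_simps)
    also have "\<dots> \<le> c2 * (1 + 1 / Cf)"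
      using \<kappa>1[OF \<kappa>(2)] Cf by (intro mult_right_mono) auto
    finally show "(d \<kappa> + \<beta> \<kappa> / (2 * \<kappa>)) * sqrt \<kappa> \<le> c2 * (1 + 1 / Cf)" .
  qed (use c in auto)
next
  fix d \<beta> :: "real \<Rightarrow> real"
  assume Cf: "Cf = 0" and order: "(\<lambda>\<kappa>. d \<kappa> + \<beta> \<kappa> / (2 * \<kappa>)) \<asymp> (\<lambda>\<kappa>. 1 / sqrt \<kappa>)"
    and params: "\<forall>\<kappa>\<ge>1. 0 < d \<kappa> \<and> 0 \<le> \<beta> \<kappa>"
  obtain c1 c2 where c: "0 < c1" "0 < c2"
    "\<forall>\<^sub>F \<kappa> in at_top. c1 \<le> (d \<kappa> + \<beta> \<kappa> / (2 * \<kappa>)) / (1 / sqrt \<kappa>)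
      \<and> (d \<kappa> + \<beta> \<kappa> / (2 * \<kappa>)) / (1 / sqrt \<kappa>) \<le> c2"
    using same_order_bounds[OF order] .
  then obtain \<kappa>1 where \<kappa>1: "\<And>\<kappa>. \<kappa>1 \<le> \<kappa> \<Longrightarrow>
      c1 \<le> (d \<kappa> + \<beta> \<kappa> / (2 * \<kappa>)) * sqrt \<kappa> \<and> (d \<kappa> + \<beta> \<kappa> / (2 * \<kappa>)) * sqrt \<kappa> \<le> c2"
    by (auto simp: eventually_at_top_linorder)
  show "accelerated A Cf Cf' d \<beta>"
    \<comment> \<open>With \<open>Cf = 0\<close> the constraint
      \<open>Cf * \<beta> \<kappa> < 2 * d \<kappa>\<close> is positivity of \<open>d\<close>, so
      the size of \<beta> is limited only through the effective damping.\<close>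
    by (rule accelerated_if_damping_comparable[OF \<open>compact A\<close>,
        where ?\<kappa>0.0 = "max 1 \<kappa>1" and ?c1.0 = c1 and ?c2.0 = c2])
      (use c \<kappa>1 params Cf in auto)
qed

end
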